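(* Let $\Omega,E,f,m$ be as in the context. Let $U$ be a uniformly integrable set of smooth probability measures on $\overline\Omega$ which satisfy the weighted Poincaré inequality $$\int_\Omega u(x)\left(g(x)-\int_\Omega ug\,dx\right)^2dx\le c\int_\Omega u(x)|\nabla g(x)|^2\,dx$$ with a uniform constant $c$ independent of $u\in U$ and $g\in C^1(\overline\Omega)$. Then for all $u\in U$ $$\int_\Omega E(x,u(x))\,dx\le C\int_\Omega u(x)|\nabla f(x,u(x))|^2\,dx,$$ where the constant $C$ may depend on $U$ but is independent of $u\in U$.
   Context: $\Omega$ is either an open connected bounded domain in $\mathbb R^d$ with sufficiently smooth boundary, or the flat torus $\mathbb T^d$. Fixed are functions $E\in C(\overline\Omega\times[0,\infty))$, $f\in C^1(\overline\Omega\times(0,\infty))$ and a probability density $m\in C(\overline\Omega)$ (so $\int_\Omega m\,dx=1$) such that: $E(x,u)\ge0$ for $(x,u)\in\overline\Omega\times[0,\infty)$; $m(x)>0$ for $x\in\overline\Omega$; $E(x,m(x))=0$ for $x\in\Omega$; $E_u(x,u)=-f(x,u)$ for $(x,u)\in\Omega\times(0,\infty)$; $f_u(x,u)<0$ for $(x,u)\in\overline\Omega\times(0,\infty)$. Smooth probability measures are identified with their smooth densities $u\ge0$, $\int_\Omega u\,dx=1$. A set $U$ of integrable functions is uniformly integrable if $\lim_{\delta\to+0}\sup\{\int_A|u|\,dx: u\in U,\ A\subset\Omega,\ |A|\le\delta\}=0$, where $|A|$ is Lebesgue measure. $\nabla f(x,u(x))$ is the full gradient of the composite function $x\mapsto f(x,u(x))$;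 the integrand $u|\nabla f|^2$ is understood to be $0$ at points where $u(x)=0$. *)

theory Defs
  imports "HOL-Analysis.Analysis"
begin

text \<open>
  The flat torus is \<open>\<real>\<^sup>d\<close> modulo the integer lattice. Functions on it are represented by functions
  on the whole space that are 1-periodic in every coordinate, subsets of it by subsets of the
  half-open unit cube. The dimension \<open>d \<ge> 1\<close> is \<open>DIM('a)\<close>.
\<close>

datatype 'a spatial = Domain "'a set" | Torus

fun pts :: "'a::euclidean_space spatial \<Rightarrow> 'a set" where
  "pts (Domain W) = W"
| "pts Torus = UNIV"

fun bar :: "'a::euclidean_space spatial \<Rightarrow> 'a set" where
  "bar (Domain W) = closure W"
| "bar Torus = UNIV"

text \<open>The set of representatives over which integrals are taken.\<close>

fun cell :: "'a::euclidean_space spatial \<Rightarrow> 'a set" where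
  "cell (Domain W) = W"
| "cell Torus = {x. \<forall>b\<in>Basis. 0 \<le> x \<bullet> b \<and> x \<bullet> b < 1}"

fun descends :: "'a::euclidean_space spatial \<Rightarrow> ('a \<Rightarrow> 'b) \<Rightarrow> bool" where
  "descends (Domain W) g \<longleftrightarrow> True"
| "descends Torus g \<longleftrightarrow> (\<forall>x. \<forall>b\<in>Basis. g (x + b) = g x)"

definition grad :: "('a::euclidean_space \<Rightarrow> real) \<Rightarrow> 'a \<Rightarrow> 'a" where
  "grad g x = (THE D. GDERIV g x :> D)"

lemma grad_eq: "GDERIV g x :> D \<Longrightarrow> grad g x = D"
  unfolding grad_def
proof (rule the_equality)
  fix D' assume "GDERIV g x :> D" "GDERIV g x :> D'"
  then have "(\<lambda>h. h \<bullet> D') = (\<lambda>h. h \<bullet> D)"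
    unfolding gderiv_def by (rule has_derivative_unique[rotated])
  then show "D' = D"
    by (metis euclidean_eqI inner_commute)
qed

text \<open>
  \<open>Ck_upto k S D g\<close> is used for open \<open>S\<close> with \<open>S \<subseteq> D \<subseteq> closure S\<close>: the function \<open>g\<close> is \<open>C\<^sup>k\<close> on \<open>S\<close>,
  and it and all its partial derivatives up to order \<open>k\<close> extend continuously to \<open>D\<close>. Values
  outside \<open>D\<close> are irrelevant; those of the witness \<open>G\<close> on \<open>D - S\<close> are the continuous extension.
\<close>

primrec Ck_upto :: "nat \<Rightarrow> 'a::euclidean_space set \<Rightarrow> 'a set \<Rightarrow> ('a \<Rightarrow> real) \<Rightarrow> bool" where
  "Ck_upto 0 S D g \<longleftrightarrow> continuous_on D g"
| "Ck_upto (Suc k) S D g \<longleftrightarrow> continuous_on D g \<and>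
     (\<exists>G. (\<forall>x\<in>S. GDERIV g x :> G x) \<and> (\<forall>b\<in>Basis. Ck_upto k S D (\<lambda>x. G x \<bullet> b)))"

definition Ck_bar :: "nat \<Rightarrow> 'a::euclidean_space spatial \<Rightarrow> ('a \<Rightarrow> real) \<Rightarrow> bool" where
  "Ck_bar k X g \<longleftrightarrow> Ck_upto k (pts X) (bar X) g \<and> descends X g"

definition smooth_bar :: "'a::euclidean_space spatial \<Rightarrow> ('a \<Rightarrow> real) \<Rightarrow> bool" where
  "smooth_bar X g \<longleftrightarrow> (\<forall>k. Ck_bar k X g)"

text \<open>
  Boundary of class \<open>C\<^sup>1\<close>, the domain lying locally on one side of it. This is the weakest reading
  of a sufficiently smooth boundary, so every higher degree of smoothness is covered.
\<close>

definition C1_boundary :: "'a::euclidean_space set \<Rightarrow> bool" where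
  "C1_boundary W \<longleftrightarrow> (\<forall>p\<in>frontier W. \<exists>V \<psi>. open V \<and> p \<in> V \<and> Ck_upto 1 V V \<psi> \<and>
     (\<forall>x\<in>V. grad \<psi> x \<noteq> 0) \<and>
     W \<inter> V = {x\<in>V. \<psi> x < 0} \<and> frontier W \<inter> V = {x\<in>V. \<psi> x = 0})"

fun admissible :: "'a::euclidean_space spatial \<Rightarrow> bool" where
  "admissible (Domain W) \<longleftrightarrow> open W \<and> connected W \<and> bounded W \<and> W \<noteq> {} \<and> C1_boundary W"
| "admissible Torus \<longleftrightarrow> True"

definition smooth_density :: "'a::euclidean_space spatial \<Rightarrow> ('a \<Rightarrow> real) \<Rightarrow> bool" where
  "smooth_density X u \<longleftrightarrow> smooth_bar X u \<and> (\<forall>x\<in>bar X. 0 \<le> u x) \<and>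
     (LINT x:cell X|lebesgue. u x) = 1"

definition uniformly_integrable :: "'a::euclidean_space spatial \<Rightarrow> ('a \<Rightarrow> real) set \<Rightarrow> bool" where
  "uniformly_integrable X U \<longleftrightarrow>
     (\<forall>u\<in>U. set_integrable lebesgue (cell X) u) \<and>
     ((\<lambda>\<delta>. SUP (u, A) \<in> {(u, A). u \<in> U \<and> A \<in> sets lebesgue \<and> A \<subseteq> cell X \<and>
                            emeasure lebesgue A \<le> ennreal \<delta>}.
             \<integral>\<^sup>+x\<in>A. ennreal \<bar>u x\<bar> \<partial>lebesgue) \<longlongrightarrow> 0) (at_right 0)"

definition weighted_Poincare ::
  "'a::euclidean_space spatial \<Rightarrow> real \<Rightarrow> ('a \<Rightarrow> real) \<Rightarrow> bool" where
  "weighted_Poincare X c u \<longleftrightarrow> (\<forall>g. Ck_bar 1 X g \<longrightarrow>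
     (LINT x:cell X|lebesgue. u x * (g x - (LINT y:cell X|lebesgue. u y * g y))\<^sup>2)
       \<le> c * (LINT x:cell X|lebesgue. u x * (norm (grad g x))\<^sup>2))"

end

theory Submission
  imports Defs
begin

text \<open>
  Since \<open>E x\<close> is convex with minimum \<open>0\<close> at \<open>m x\<close>, the function \<open>f x\<close> decreases strictly and vanishes at
  \<open>m x\<close>. Write \<open>I(u)\<close> for the integral on the right, fix a small level \<open>s0 < min m\<close>, and let \<open>P(u)\<close> be
  the measure of \<open>{u \<le> s0}\<close>. The proof bounds the energy in two stages, by \<open>I(u) + P(u)\<close> and then by
  \<open>I(u)\<close> alone.

  The Poincare inequality cannot be applied to \<open>f(x, u(x))\<close> itself, which may blow up or be
  discontinuous where \<open>u\<close> vanishes. But \<open>f(x, s) \<ge> 2\<kappa> > 0\<close> for \<open>s \<le> s0\<close>, so \<open>\<psi>(f(x, u(x)))\<close> is \<open>C\<^sup>1\<close> as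
  soon as \<open>\<psi>\<close> is \<open>C\<^sup>1\<close> and constant on \<open>[2\<kappa>, \<infinity>)\<close>, and its gradient lives on \<open>{u > s0}\<close>, where the
  weight \<open>u\<close> is bounded below (\<open>truncated_composition\<close>, \<open>grad_energy_le\<close>).

  First stage (\<open>energy_le_dissipation_plus_low_set\<close>). Let \<open>g\<close> be such a truncation of \<open>f(x, u(x))\<close> that
  agrees with it below \<open>\<kappa>\<close>. On \<open>{u > s0}\<close> the energy density is at most a multiple of \<open>u g\<^sup>2\<close>, and on
  \<open>{u \<le> s0}\<close> it is bounded. The integral of \<open>u g\<^sup>2\<close> is the variance of \<open>g\<close> with respect to \<open>u\<close>, which
  the Poincare inequality controls, plus the squared mean. The mean is controlled because \<open>u\<close> and \<open>m\<close>
  have the same mass: \<open>m - u\<close> is a positive multiple of \<open>g\<close> on \<open>{u > s0}\<close>, so a \<open>g\<close> that is nearly a nonzero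
  constant would unbalance the masses.

  Second stage (\<open>low_set_le_dissipation\<close>). A step function of \<open>f(x, u(x))\<close> that is \<open>1\<close> on \<open>{u \<le> s0}\<close> and
  \<open>0\<close> where \<open>f(x, u(x))\<close> is small has gradient energy at most a multiple of \<open>I(u)\<close> for Lebesgue
  measure. By equality of masses and uniform integrability the second of these sets is never small, and
  on a connected set two sets that are not small cannot be separated with little energy
  (\<open>small_energy_separates_no_large_sets\<close>). Hence \<open>u\<close> is close to \<open>m\<close> in \<open>L\<^sup>1\<close> when \<open>I(u)\<close> is small.
  So there are two cases. If \<open>m\<close> is not an \<open>L\<^sup>1\<close>-limit of members of \<open>U\<close>, then \<open>I\<close> is bounded below on \<open>U\<close>,
  and \<open>P\<close> is at most the measure of the domain. If it is, the Poincare inequality passes to the limit and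
  holds for the weight \<open>m\<close>; since \<open>m\<close> is bounded below, applying it to the step function turns the
  qualitative separation into the linear bound \<open>P(u) \<le> C I(u)\<close> for small \<open>I(u)\<close>.
\<close>

section \<open>Functions of small gradient energy on a connected open set\<close>

definition C1_on :: "'a::euclidean_space set \<Rightarrow> ('a \<Rightarrow> real) \<Rightarrow> ('a \<Rightarrow> 'a) \<Rightarrow> bool" where
  "C1_on W h G \<longleftrightarrow> (\<forall>x\<in>W. GDERIV h x :> G x) \<and> continuous_on W G"

lemma C1_on_continuous: "C1_on W h G \<Longrightarrow> continuous_on W h"
  unfolding C1_on_def by (meson GDERIV_DERIV_compose continuous_at_imp_continuous_on gderiv_def has_derivative_continuous)

lemma nn_integral_translation:
  fixes F :: "'a::euclidean_space \<Rightarrow> ennreal"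
  assumes "F \<in> borel_measurable borel"
  shows "(\<integral>\<^sup>+x. F (a + x) \<partial>lborel) = (\<integral>\<^sup>+x. F x \<partial>lborel)"
proof -
  have "(\<integral>\<^sup>+x. F x \<partial>lborel) = (\<integral>\<^sup>+x. F x \<partial>distr lborel borel ((+) a))"
    by (simp add: lborel_distr_plus)
  also have "\<dots> = (\<integral>\<^sup>+x. F (a + x) \<partial>lborel)"
    by (rule nn_integral_distr) (use assms in auto)
  finally show ?thesis ..
qed

lemma diff_le_nn_integral_gradient_on_segment:
  assumes h: "C1_on W h G" and seg: "\<And>t. t \<in> {0..1} \<Longrightarrow> x + t *\<^sub>R v \<in> W"
  shows "ennreal \<bar>h (x + v) - h x\<bar>
     \<le> (\<integral>\<^sup>+t\<in>{0..1}. ennreal (norm v) * ennreal (norm (G (x + t *\<^sub>R v))) \<partial>lborel)"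
proof -
  let ?F = "\<lambda>t. G (x + t *\<^sub>R v) \<bullet> v"
  let ?N = "\<lambda>t. norm v * norm (G (x + t *\<^sub>R v))"
  have contG: "continuous_on {0..1} (\<lambda>t. G (x + t *\<^sub>R v))"
    by (rule continuous_on_compose2[of W G]) (use h seg in \<open>auto simp: C1_on_def intro!: continuous_intros\<close>)
  have der: "((\<lambda>t. h (x + t *\<^sub>R v)) has_vector_derivative ?F t) (at t within {0..1})" if "t \<in> {0..1}" for t
  proof -
    have "(h has_derivative (\<lambda>y. y \<bullet> G (x + t *\<^sub>R v))) (at (x + t *\<^sub>R v))"
      using h seg[OF that] by (auto simp: C1_on_def gderiv_def)
    moreover have "((\<lambda>t. x + t *\<^sub>R v) has_derivative (\<lambda>s. s *\<^sub>R v)) (at t within {0..1})"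
      by (auto intro!: derivative_eq_intros)
    ultimately have "((\<lambda>t. h (x + t *\<^sub>R v)) has_derivative (\<lambda>s. (s *\<^sub>R v) \<bullet> G (x + t *\<^sub>R v))) (at t within {0..1})"
      by (rule has_derivative_compose[rotated])
    then show ?thesis
      by (simp add: has_vector_derivative_def inner_commute)
  qed
  have "(?F has_integral (h (x + 1 *\<^sub>R v) - h (x + 0 *\<^sub>R v))) {0..1}"
    by (rule fundamental_theorem_of_calculus) (use der in auto)
  then have I: "(?F has_integral (h (x + v) - h x)) {0..1}" by simp
  have contN: "continuous_on {0..1} ?N" by (intro continuous_intros contG)
  then have Ni: "?N integrable_on {0..1}" by (rule integrable_continuous_real)
  have "\<bar>h (x + v) - h x\<bar> \<le> integral {0..1} ?N"
  proof -
    have "norm (integral {0..1} ?F) \<le> integral {0..1} ?N"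
    proof (intro integral_norm_bound_integral has_integral_integrable[OF I] Ni)
      show "norm (?F t) \<le> ?N t" for t
        using Cauchy_Schwarz_ineq2[of "G (x + t *\<^sub>R v)" v] by (simp add: mult.commute)
    qed
    then show ?thesis by (simp add: integral_unique[OF I])
  qed
  also have "set_integrable lborel {0..1} ?N"
    by (rule borel_integrable_atLeastAtMost') (rule contN)
  then have "integral {0..1} ?N = (LINT t:{0..1}|lborel. ?N t)"
    by (rule set_borel_integral_eq_integral(2)[symmetric])
  finally have "ennreal \<bar>h (x + v) - h x\<bar> \<le> ennreal (LINT t:{0..1}|lborel. ?N t)"
    by (rule ennreal_leI)
  also have "\<dots> = (\<integral>\<^sup>+t. ennreal (indicator {0..1} t *\<^sub>R ?N t) \<partial>lborel)"
    unfolding set_lebesgue_integral_def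
    using \<open>set_integrable lborel {0..1} ?N\<close>
    by (intro nn_integral_eq_integral[symmetric]) (auto simp: set_integrable_def)
  also have "\<dots> = (\<integral>\<^sup>+t\<in>{0..1}. ennreal (norm v) * ennreal (norm (G (x + t *\<^sub>R v))) \<partial>lborel)"
    by (intro nn_integral_cong) (auto simp: indicator_def ennreal_mult)
  finally show ?thesis .
qed

text \<open>
  Integrating the bound along segments over \<open>x\<close> and exchanging the integrals leaves, at each time \<open>t\<close>,
  the gradient integrated over a translate of \<open>S\<close> inside \<open>W\<close>.
\<close>

lemma nn_integral_translation_diff_le:
  fixes h :: "'a::euclidean_space \<Rightarrow> real"
  assumes h: "C1_on W h G" and W: "open W" and S: "S \<in> sets borel"
    and seg: "\<And>x t. x \<in> S \<Longrightarrow> t \<in> {0..1} \<Longrightarrow> x + t *\<^sub>R v \<in> W"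
  shows "(\<integral>\<^sup>+x\<in>S. ennreal \<bar>h (x + v) - h x\<bar> \<partial>lborel)
     \<le> ennreal (norm v) * (\<integral>\<^sup>+x\<in>W. ennreal (norm (G x)) \<partial>lborel)"
proof -
  define N where "N x = ennreal (norm (indicator W x *\<^sub>R G x))" for x
  have [measurable]: "W \<in> sets borel" "S \<in> sets borel" using W S by auto
  have [measurable]: "(\<lambda>x. indicator W x *\<^sub>R G x) \<in> borel_measurable borel"
    using h by (intro borel_measurable_continuous_on_indicator) (auto simp: C1_on_def)
  have N[measurable]: "N \<in> borel_measurable borel" unfolding N_def by measurable
  have "(\<integral>\<^sup>+x\<in>S. ennreal \<bar>h (x + v) - h x\<bar> \<partial>lborel)
    \<le> (\<integral>\<^sup>+x. (\<integral>\<^sup>+t. indicator S x * indicator {0..1} t * (ennreal (norm v) * N (x + t *\<^sub>R v)) \<partial>lborel) \<partial>lborel)"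
  proof (intro nn_integral_mono)
    fix x
    show "ennreal \<bar>h (x + v) - h x\<bar> * indicator S x
      \<le> (\<integral>\<^sup>+t. indicator S x * indicator {0..1} t * (ennreal (norm v) * N (x + t *\<^sub>R v)) \<partial>lborel)"
    proof (cases "x \<in> S")
      case True
      have "ennreal \<bar>h (x + v) - h x\<bar>
          \<le> (\<integral>\<^sup>+t\<in>{0..1}. ennreal (norm v) * ennreal (norm (G (x + t *\<^sub>R v))) \<partial>lborel)"
        using seg True by (intro diff_le_nn_integral_gradient_on_segment[OF h]) auto
      also have "\<dots> = (\<integral>\<^sup>+t. indicator S x * indicator {0..1} t * (ennreal (norm v) * N (x + t *\<^sub>R v)) \<partial>lborel)"
        using True seg by (intro nn_integral_cong) (auto simp: indicator_def N_def)
      finally show ?thesis using True by simp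
    qed simp
  qed
  also have "\<dots> = (\<integral>\<^sup>+t. (\<integral>\<^sup>+x. indicator S x * indicator {0..1} t * (ennreal (norm v) * N (x + t *\<^sub>R v)) \<partial>lborel) \<partial>lborel)"
    by (rule lborel_pair.Fubini') measurable
  also have "\<dots> \<le> (\<integral>\<^sup>+t. indicator {0..1::real} t * (ennreal (norm v) * (\<integral>\<^sup>+x. N x \<partial>lborel)) \<partial>lborel)"
  proof (intro nn_integral_mono)
    fix t :: real
    have "(\<integral>\<^sup>+x. indicator S x * indicator {0..1} t * (ennreal (norm v) * N (x + t *\<^sub>R v)) \<partial>lborel)
      \<le> (\<integral>\<^sup>+x. (indicator {0..1} t * ennreal (norm v)) * N (t *\<^sub>R v + x) \<partial>lborel)"
      by (intro nn_integral_mono) (auto simp: indicator_def add.commute)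
    also have "\<dots> = (indicator {0..1} t * ennreal (norm v)) * (\<integral>\<^sup>+x. N (t *\<^sub>R v + x) \<partial>lborel)"
      by (rule nn_integral_cmult) measurable
    finally show "(\<integral>\<^sup>+x. indicator S x * indicator {0..1} t * (ennreal (norm v) * N (x + t *\<^sub>R v)) \<partial>lborel)
      \<le> indicator {0..1::real} t * (ennreal (norm v) * (\<integral>\<^sup>+x. N x \<partial>lborel))"
      by (simp add: nn_integral_translation mult.assoc)
  qed
  also have "\<dots> = ennreal (norm v) * (\<integral>\<^sup>+x. N x \<partial>lborel)"
    by (subst nn_integral_multc) auto
  also have "(\<integral>\<^sup>+x. N x \<partial>lborel) = (\<integral>\<^sup>+x\<in>W. ennreal (norm (G x)) \<partial>lborel)"
    by (intro nn_integral_cong) (auto simp: N_def indicator_def)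
  finally show ?thesis .
qed

text \<open>
  This is a Poincare inequality on \<open>S\<close> in \<open>L\<^sup>1\<close> form, with the gradient taken over all of \<open>W\<close> and a constant
  that may depend on \<open>S\<close> but not on \<open>h\<close>. Comparing the gradient integral with a positive real \<open>d\<close> covers
  the vanishing gradient integrals without a separate case.
\<close>

definition nearly_constant_on :: "'a::euclidean_space set \<Rightarrow> 'a set \<Rightarrow> bool" where
  "nearly_constant_on W S \<longleftrightarrow> S \<in> sets borel \<and> S \<subseteq> W \<and>
     (\<exists>C>0. \<forall>d>0. \<forall>h G. C1_on W h G \<and> (\<integral>\<^sup>+x\<in>W. ennreal (norm (G x)) \<partial>lborel) \<le> ennreal d \<longrightarrow>
        (\<exists>a. (\<integral>\<^sup>+x\<in>S. ennreal \<bar>h x - a\<bar> \<partial>lborel) \<le> ennreal (C * d)))"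

lemma nearly_constant_onE:
  assumes "nearly_constant_on W S"
  obtains C where "C > 0" "\<And>d h G. d > 0 \<Longrightarrow> C1_on W h G \<Longrightarrow>
      (\<integral>\<^sup>+x\<in>W. ennreal (norm (G x)) \<partial>lborel) \<le> ennreal d \<Longrightarrow>
      \<exists>a. (\<integral>\<^sup>+x\<in>S. ennreal \<bar>h x - a\<bar> \<partial>lborel) \<le> ennreal (C * d)"
  using assms unfolding nearly_constant_on_def by blast

text \<open>
  The double integral of \<open>\<bar>h x - h y\<bar>\<close> over the ball becomes, with \<open>y = x + v\<close>, an integral over \<open>v\<close> of the
  translation differences, each controlled by the gradient integral. So the inner integral is small for some \<open>y\<close>, and \<open>h y\<close> serves
  as the constant.
\<close>

lemma nearly_constant_on_ball:
  fixes p :: "'a::euclidean_space"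
  assumes W: "open W" and r: "0 < r" "ball p r \<subseteq> W"
  shows "nearly_constant_on W (ball p r)"
proof -
  let ?B = "ball p r"
  let ?V = "ball (0::'a) (2 * r)"
  have [measurable]: "?B \<in> sets borel" "?V \<in> sets borel" by auto
  define K where "K = 2 * r * measure lborel ?V"
  define b where "b = measure lborel ?B"
  have b: "0 < b" using r(1) by (simp add: b_def content_ball_pos)
  have eb: "emeasure lborel ?B = ennreal b" unfolding b_def
    by (rule emeasure_eq_ennreal_measure) (use emeasure_bounded_finite[of ?B] in auto)
  have K0: "0 \<le> K" using r(1) by (simp add: K_def)
  define C where "C = (K + 1) / b"
  have C: "0 < C" using b K0 by (simp add: C_def)
  have "\<exists>a. (\<integral>\<^sup>+x\<in>?B. ennreal \<bar>h x - a\<bar> \<partial>lborel) \<le> ennreal (C * d)"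
    if d: "0 < d" and h: "C1_on W h G" and D: "(\<integral>\<^sup>+x\<in>W. ennreal (norm (G x)) \<partial>lborel) \<le> ennreal d" for d h G
  proof (rule ccontr)
    assume "\<not> ?thesis"
    then have big: "ennreal (C * d) < (\<integral>\<^sup>+x\<in>?B. ennreal \<bar>h x - a\<bar> \<partial>lborel)" for a
      by (simp add: not_le)
    define h0 where "h0 x = indicator ?B x *\<^sub>R h x" for x
    have [measurable]: "h0 \<in> borel_measurable borel"
      unfolding h0_def by (intro borel_measurable_continuous_on_indicator)
        (use C1_on_continuous[OF h] r(2) in \<open>auto intro: continuous_on_subset\<close>)
    have "ennreal ((K + 1) * d) = (\<integral>\<^sup>+y. ennreal (C * d) * indicator ?B y \<partial>lborel)"
      by (subst nn_integral_cmult_indicator) (use b d K0 in \<open>auto simp: eb ennreal_mult[symmetric] C_def\<close>)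
    also have "\<dots> \<le> (\<integral>\<^sup>+y. (\<integral>\<^sup>+x. indicator ?B x * indicator ?B y * ennreal \<bar>h0 y - h0 x\<bar> \<partial>lborel) \<partial>lborel)"
    proof (intro nn_integral_mono)
      fix y
      have "(\<integral>\<^sup>+x\<in>?B. ennreal \<bar>h x - h y\<bar> \<partial>lborel)
         = (\<integral>\<^sup>+x. indicator ?B x * indicator ?B y * ennreal \<bar>h0 y - h0 x\<bar> \<partial>lborel)" if "y \<in> ?B"
        using that by (intro nn_integral_cong) (auto simp: indicator_def h0_def abs_minus_commute)
      then show "ennreal (C * d) * indicator ?B y
          \<le> (\<integral>\<^sup>+x. indicator ?B x * indicator ?B y * ennreal \<bar>h0 y - h0 x\<bar> \<partial>lborel)"
        using big[of "h y"] by (cases "y \<in> ?B") auto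
    qed
    also have "\<dots> = (\<integral>\<^sup>+x. (\<integral>\<^sup>+y. indicator ?B x * indicator ?B y * ennreal \<bar>h0 y - h0 x\<bar> \<partial>lborel) \<partial>lborel)"
      by (rule lborel_pair.Fubini') simp
    also have "\<dots> = (\<integral>\<^sup>+x. (\<integral>\<^sup>+v. indicator ?B x * indicator ?B (x + v) * ennreal \<bar>h0 (x + v) - h0 x\<bar> \<partial>lborel) \<partial>lborel)"
      by (intro nn_integral_cong nn_integral_translation[symmetric]) measurable
    also have "\<dots> = (\<integral>\<^sup>+v. (\<integral>\<^sup>+x. indicator ?B x * indicator ?B (x + v) * ennreal \<bar>h0 (x + v) - h0 x\<bar> \<partial>lborel) \<partial>lborel)"
      by (rule lborel_pair.Fubini'[symmetric]) measurable
    also have "\<dots> \<le> (\<integral>\<^sup>+v. ennreal (2 * r * d) * indicator ?V v \<partial>lborel)"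
    proof (intro nn_integral_mono)
      fix v :: 'a
      let ?S = "{x. x \<in> ?B \<and> x + v \<in> ?B}"
      have eq: "(\<integral>\<^sup>+x. indicator ?B x * indicator ?B (x + v) * ennreal \<bar>h0 (x + v) - h0 x\<bar> \<partial>lborel)
           = (\<integral>\<^sup>+x\<in>?S. ennreal \<bar>h (x + v) - h x\<bar> \<partial>lborel)"
        by (intro nn_integral_cong) (auto simp: indicator_def h0_def)
      show "(\<integral>\<^sup>+x. indicator ?B x * indicator ?B (x + v) * ennreal \<bar>h0 (x + v) - h0 x\<bar> \<partial>lborel)
          \<le> ennreal (2 * r * d) * indicator ?V v"
      proof (cases "v \<in> ?V")
        case False
        have "norm v < 2 * r" if "x \<in> ?S" for x
        proof -
          have "norm v = dist x (x + v)" by (simp add: dist_norm)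
          also have "\<dots> \<le> dist p x + dist p (x + v)" by (rule dist_triangle3)
          also have "\<dots> < 2 * r" using that by simp
          finally show ?thesis .
        qed
        then have "?S = {}" using False by auto
        then show ?thesis unfolding eq by simp
      next
        case True
        have "(\<integral>\<^sup>+x\<in>?S. ennreal \<bar>h (x + v) - h x\<bar> \<partial>lborel)
           \<le> ennreal (norm v) * (\<integral>\<^sup>+x\<in>W. ennreal (norm (G x)) \<partial>lborel)"
        proof (rule nn_integral_translation_diff_le[OF h W])
          show "?S \<in> sets borel" by measurable
          fix x and t :: real assume "x \<in> ?S" "t \<in> {0..1}"
          then have "(1 - t) *\<^sub>R x + t *\<^sub>R (x + v) \<in> ?B"
            by (intro convexD[OF convex_ball]) auto
          then show "x + t *\<^sub>R v \<in> W" using r(2) by (auto simp: algebra_simps)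
        qed
        also have "\<dots> \<le> ennreal (2 * r) * ennreal d"
          using True D by (intro mult_mono ennreal_leI) auto
        finally show ?thesis unfolding eq using True r(1) d by (simp add: ennreal_mult)
      qed
    qed
    also have "\<dots> = ennreal (2 * r * d) * emeasure lborel ?V"
      by (simp add: nn_integral_cmult)
    also have "emeasure lborel ?V = ennreal (measure lborel ?V)"
      by (rule emeasure_eq_ennreal_measure) (use emeasure_bounded_finite[of ?V] in auto)
    also have "ennreal (2 * r * d) * \<dots> = ennreal (K * d)"
      using r(1) d by (simp add: ennreal_mult[symmetric] K_def mult_ac)
    finally have "(K + 1) * d \<le> K * d" using K0 d by (simp add: ennreal_le_iff)
    then show False using d by (simp add: algebra_simps)
  qed
  then show ?thesis unfolding nearly_constant_on_def using r C by auto
qed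

text \<open>
  On the overlap \<open>h\<close> is close to both constants, so these differ by at most a multiple of \<open>d\<close>.
\<close>

lemma nearly_constant_on_Un:
  fixes S S' :: "'a::euclidean_space set"
  assumes W: "open W" "bounded W" and P: "nearly_constant_on W S" "nearly_constant_on W S'"
    and pos: "0 < measure lborel (S \<inter> S')"
  shows "nearly_constant_on W (S \<union> S')"
proof -
  have S[measurable]: "S \<in> sets borel" and SW: "S \<subseteq> W"
    using P unfolding nearly_constant_on_def by auto
  obtain C where C: "C > 0"
    and CS: "\<And>d h G. d > 0 \<Longrightarrow> C1_on W h G \<Longrightarrow> (\<integral>\<^sup>+x\<in>W. ennreal (norm (G x)) \<partial>lborel) \<le> ennreal d \<Longrightarrow>
        \<exists>a. (\<integral>\<^sup>+x\<in>S. ennreal \<bar>h x - a\<bar> \<partial>lborel) \<le> ennreal (C * d)"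
    using nearly_constant_onE[OF P(1)] by blast
  have S'[measurable]: "S' \<in> sets borel" and SW': "S' \<subseteq> W"
    using P unfolding nearly_constant_on_def by auto
  obtain C' where C': "C' > 0"
    and CS': "\<And>d h G. d > 0 \<Longrightarrow> C1_on W h G \<Longrightarrow> (\<integral>\<^sup>+x\<in>W. ennreal (norm (G x)) \<partial>lborel) \<le> ennreal d \<Longrightarrow>
        \<exists>a. (\<integral>\<^sup>+x\<in>S'. ennreal \<bar>h x - a\<bar> \<partial>lborel) \<le> ennreal (C' * d)"
    using nearly_constant_onE[OF P(2)] by blast
  define p where "p = measure lborel (S \<inter> S')"
  define q where "q = measure lborel S'"
  have fin: "A \<subseteq> W \<Longrightarrow> emeasure lborel A = ennreal (measure lborel A)" for A
    using emeasure_bounded_finite[of A] bounded_subset[OF W(2)] by (intro emeasure_eq_ennreal_measure) auto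
  have ep: "emeasure lborel (S \<inter> S') = ennreal p" and eq: "emeasure lborel S' = ennreal q"
    using SW SW' by (auto simp: p_def q_def intro!: fin)
  have p: "p > 0" using pos by (simp add: p_def)
  have q: "q \<ge> 0" by (simp add: q_def)
  define L where "L = C + C' + (C + C') / p * q"
  have L: "L > 0" using C C' p q by (simp add: L_def add_pos_nonneg)
  have "\<exists>a. (\<integral>\<^sup>+x\<in>S \<union> S'. ennreal \<bar>h x - a\<bar> \<partial>lborel) \<le> ennreal (L * d)"
    if d: "0 < d" and h: "C1_on W h G" and D: "(\<integral>\<^sup>+x\<in>W. ennreal (norm (G x)) \<partial>lborel) \<le> ennreal d" for d h G
  proof -
    obtain a where a: "(\<integral>\<^sup>+x\<in>S. ennreal \<bar>h x - a\<bar> \<partial>lborel) \<le> ennreal (C * d)" using CS d h D by blast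
    obtain a' where a': "(\<integral>\<^sup>+x\<in>S'. ennreal \<bar>h x - a'\<bar> \<partial>lborel) \<le> ennreal (C' * d)" using CS' d h D by blast
    define h0 where "h0 x = indicator W x *\<^sub>R h x" for x
    have [measurable]: "h0 \<in> borel_measurable borel"
      unfolding h0_def using W C1_on_continuous[OF h] by (intro borel_measurable_continuous_on_indicator) auto
    have conv: "(\<integral>\<^sup>+x\<in>A. ennreal \<bar>h x - z\<bar> \<partial>lborel) = (\<integral>\<^sup>+x\<in>A. ennreal \<bar>h0 x - z\<bar> \<partial>lborel)" if "A \<subseteq> W" for A z
      using that by (intro nn_integral_cong) (auto simp: indicator_def h0_def)
    note a = a[unfolded conv[OF SW]] and a' = a'[unfolded conv[OF SW']]
    have "ennreal (\<bar>a - a'\<bar> * p) = (\<integral>\<^sup>+x. ennreal \<bar>a - a'\<bar> * indicator (S \<inter> S') x \<partial>lborel)"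
      using p by (simp add: nn_integral_cmult ep ennreal_mult)
    also have "\<dots> \<le> (\<integral>\<^sup>+x. ennreal \<bar>h0 x - a\<bar> * indicator S x + ennreal \<bar>h0 x - a'\<bar> * indicator S' x \<partial>lborel)"
      by (intro nn_integral_mono) (auto simp: indicator_def ennreal_plus[symmetric] simp del: ennreal_plus)
    also have "\<dots> = (\<integral>\<^sup>+x\<in>S. ennreal \<bar>h0 x - a\<bar> \<partial>lborel) + (\<integral>\<^sup>+x\<in>S'. ennreal \<bar>h0 x - a'\<bar> \<partial>lborel)"
      by (rule nn_integral_add) measurable
    also have "\<dots> \<le> ennreal (C * d) + ennreal (C' * d)" by (intro add_mono a a')
    finally have "\<bar>a - a'\<bar> * p \<le> C * d + C' * d"
      using C C' d by (simp add: ennreal_plus[symmetric] ennreal_le_iff del: ennreal_plus)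
    then have diff: "\<bar>a - a'\<bar> \<le> (C + C') / p * d" using p by (simp add: field_simps)
    have "(\<integral>\<^sup>+x\<in>S \<union> S'. ennreal \<bar>h0 x - a\<bar> \<partial>lborel)
       \<le> (\<integral>\<^sup>+x. ennreal \<bar>h0 x - a\<bar> * indicator S x + (ennreal \<bar>h0 x - a'\<bar> * indicator S' x
             + ennreal \<bar>a - a'\<bar> * indicator S' x) \<partial>lborel)"
      by (intro nn_integral_mono) (auto simp: indicator_def ennreal_plus[symmetric] simp del: ennreal_plus)
    also have "\<dots> = (\<integral>\<^sup>+x\<in>S. ennreal \<bar>h0 x - a\<bar> \<partial>lborel)
       + ((\<integral>\<^sup>+x\<in>S'. ennreal \<bar>h0 x - a'\<bar> \<partial>lborel) + ennreal \<bar>a - a'\<bar> * emeasure lborel S')"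
      by (simp add: nn_integral_add nn_integral_cmult)
    also have "\<dots> \<le> ennreal (C * d) + (ennreal (C' * d) + ennreal ((C + C') / p * d) * ennreal q)"
      unfolding eq by (intro add_mono a a' mult_right_mono ennreal_leI diff) auto
    also have "\<dots> = ennreal (L * d)"
      using C C' p q d by (simp add: L_def ennreal_plus[symmetric] ennreal_mult[symmetric] algebra_simps del: ennreal_plus)
    finally show ?thesis using conv[of "S \<union> S'" a] SW SW' by (intro exI[of _ a]) auto
  qed
  then show ?thesis unfolding nearly_constant_on_def using SW SW' L by auto
qed

lemma measure_pos_if_interior:
  fixes A :: "'a::euclidean_space set"
  assumes "x \<in> interior A" "A \<in> sets borel" "bounded A"
  shows "0 < measure lborel A"
proof -
  obtain e where e: "e > 0" "ball x e \<subseteq> A"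
    using assms(1) by (meson mem_interior)
  have "0 < measure lborel (ball x e)" using e(1) by (simp add: content_ball_pos)
  also have "\<dots> \<le> measure lborel A"
    using e assms emeasure_bounded_finite[of A]
    by (intro measure_mono_fmeasurable) (auto simp: fmeasurable_def)
  finally show ?thesis .
qed

lemma nearly_constant_on_Un_common_interior:
  assumes "open W" "bounded W" "nearly_constant_on W S" "nearly_constant_on W S'"
    "x \<in> interior S" "x \<in> interior S'"
  shows "nearly_constant_on W (S \<union> S')"
proof (rule nearly_constant_on_Un)
  show "0 < measure lborel (S \<inter> S')"
    using assms unfolding nearly_constant_on_def
    by (intro measure_pos_if_interior[of x]) (auto intro: bounded_subset)
qed (use assms in auto)

text \<open>
  Lying in the interior of a common nearly constant set is an equivalence relation with open classes, so
  connectedness leaves a single class.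
\<close>

lemma nearly_constant_on_two_points:
  assumes W: "open W" "connected W" "bounded W" and pq: "p \<in> W" "q \<in> W"
  shows "\<exists>S. nearly_constant_on W S \<and> p \<in> interior S \<and> q \<in> interior S"
proof (rule connected_equivalence_relation[OF W(2) pq, where R = "\<lambda>p q. \<exists>S. nearly_constant_on W S \<and> p \<in> interior S \<and> q \<in> interior S"])
  fix x y z
  assume "\<exists>S. nearly_constant_on W S \<and> x \<in> interior S \<and> y \<in> interior S"
    and "\<exists>S. nearly_constant_on W S \<and> y \<in> interior S \<and> z \<in> interior S"
  then obtain S S' where "nearly_constant_on W S" "x \<in> interior S" "y \<in> interior S"
    "nearly_constant_on W S'" "y \<in> interior S'" "z \<in> interior S'" by blast
  then show "\<exists>S. nearly_constant_on W S \<and> x \<in> interior S \<and> z \<in> interior S"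
    using nearly_constant_on_Un_common_interior[OF W(1,3)] interior_mono[of S "S \<union> S'"] interior_mono[of S' "S \<union> S'"]
    by (intro exI[of _ "S \<union> S'"]) blast
next
  fix a assume "a \<in> W"
  then obtain r where r: "r > 0" "ball a r \<subseteq> W" using W(1) openE by blast
  then show "\<exists>T. openin (top_of_set W) T \<and> a \<in> T \<and> (\<forall>x\<in>T. \<exists>S. nearly_constant_on W S \<and> a \<in> interior S \<and> x \<in> interior S)"
    using nearly_constant_on_ball[OF W(1) r] W(1)
    by (intro exI[of _ "ball a r"]) (auto simp: openin_open_eq interior_open intro!: exI[of _ "ball a r"])
qed blast

lemma nearly_constant_on_superset_of_compact:
  assumes W: "open W" "connected W" "bounded W" and ne: "W \<noteq> {}" and K: "compact K" "K \<subseteq> W"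
  shows "\<exists>S. nearly_constant_on W S \<and> K \<subseteq> S"
proof -
  obtain p where p: "p \<in> W" using ne by blast
  obtain S where S: "\<And>q. q \<in> W \<Longrightarrow> nearly_constant_on W (S q) \<and> p \<in> interior (S q) \<and> q \<in> interior (S q)"
    using nearly_constant_on_two_points[OF W p] by metis
  have "K \<subseteq> (\<Union>q\<in>W. interior (S q))" using S K(2) by blast
  then obtain Q where Q: "Q \<subseteq> W" "finite Q" "K \<subseteq> (\<Union>q\<in>Q. interior (S q))"
    using compactE_image[OF K(1), of W "\<lambda>q. interior (S q)"] by auto
  have "nearly_constant_on W (S p \<union> (\<Union>q\<in>Q. S q)) \<and> p \<in> interior (S p \<union> (\<Union>q\<in>Q. S q))"
    using Q(2,1)
  proof (induction Q rule: finite_induct)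
    case empty
    then show ?case using S[OF p] by simp
  next
    case (insert q Q)
    have "nearly_constant_on W ((S p \<union> (\<Union>q\<in>Q. S q)) \<union> S q)"
      by (rule nearly_constant_on_Un_common_interior[OF W(1,3), of _ _ p]) (use insert S in auto)
    moreover have "p \<in> interior ((S p \<union> (\<Union>q\<in>Q. S q)) \<union> S q)"
      using insert interior_mono[of "S p \<union> (\<Union>q\<in>Q. S q)" "(S p \<union> (\<Union>q\<in>Q. S q)) \<union> S q"] by auto
    ultimately show ?case by (simp add: Un_ac)
  qed
  then show ?thesis using Q(3) interior_subset by (intro exI[of _ "S p \<union> (\<Union>q\<in>Q. S q)"]) blast
qed

lemma measure_lborel_Int_ge:
  assumes [measurable]: "Z \<in> sets borel" "W \<in> sets borel" "T \<in> sets borel" "S \<in> sets borel"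
    and "Z \<subseteq> W" "T \<subseteq> S" "S \<subseteq> W" "bounded W" and "measure lborel (W - T) \<le> e"
  shows "measure lborel Z - e \<le> measure lborel (Z \<inter> S)"
proof -
  have fin: "A \<in> fmeasurable lborel" if "A \<subseteq> W" "A \<in> sets borel" for A
    using that emeasure_bounded_finite[of A] bounded_subset[of W A] assms by (auto simp: fmeasurable_def)
  have "measure lborel Z \<le> measure lborel ((Z \<inter> S) \<union> (W - T))"
    by (intro measure_mono_fmeasurable fin) (use assms in auto)
  also have "\<dots> \<le> measure lborel (Z \<inter> S) + measure lborel (W - T)"
    by (intro measure_Un_le) auto
  finally show ?thesis using assms by simp
qed

text \<open>
  All of \<open>W\<close> up to measure \<open>\<eta> / 2\<close> lies in a compact subset, hence in a set on which \<open>h\<close> is \<open>L\<^sup>1\<close>-close to one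
  constant. That constant cannot be close to \<open>0\<close> and to \<open>1\<close> at once.
\<close>

lemma small_energy_separates_no_large_sets:
  fixes W :: "'a::euclidean_space set"
  assumes W: "open W" "connected W" "bounded W" and eta: "0 < \<eta>"
  shows "\<exists>\<delta>>0. \<forall>h G. C1_on W h G \<and> (\<integral>\<^sup>+x\<in>W. ennreal ((norm (G x))\<^sup>2) \<partial>lborel) \<le> ennreal \<delta> \<longrightarrow>
     measure lborel {x\<in>W. h x = 0} < \<eta> \<or> measure lborel {x\<in>W. h x = 1} < \<eta>"
proof (cases "W = {}")
  case True
  then show ?thesis using eta by (intro exI[of _ 1]) auto
next
  case False
  have [measurable]: "W \<in> sets borel" using W by auto
  obtain T where T: "closed T" "T \<subseteq> W" "W - T \<in> lmeasurable" "emeasure lebesgue (W - T) < ennreal (\<eta> / 2)"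
    using sets_lebesgue_inner_closed[of W "\<eta> / 2"] eta by auto
  have [measurable]: "T \<in> sets borel" using T by auto
  have mT: "measure lborel (W - T) \<le> \<eta> / 2"
    using T(3,4) eta by (simp add: emeasure_eq_measure2 ennreal_less_iff)
  have "compact T" using T W(3) bounded_subset compact_eq_bounded_closed by blast
  then obtain S where S: "nearly_constant_on W S" "T \<subseteq> S"
    using nearly_constant_on_superset_of_compact[OF W False] T by blast
  have [measurable]: "S \<in> sets borel" and SW: "S \<subseteq> W" using S unfolding nearly_constant_on_def by auto
  obtain C where C: "C > 0" and CS: "\<And>d h G. d > 0 \<Longrightarrow> C1_on W h G \<Longrightarrow>
      (\<integral>\<^sup>+x\<in>W. ennreal (norm (G x)) \<partial>lborel) \<le> ennreal d \<Longrightarrow>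
      \<exists>a. (\<integral>\<^sup>+x\<in>S. ennreal \<bar>h x - a\<bar> \<partial>lborel) \<le> ennreal (C * d)"
    using nearly_constant_onE[OF S(1)] by blast
  define d where "d = \<eta> / (8 * C)"
  have d: "d > 0" using eta C by (simp add: d_def)
  define w where "w = measure lborel W"
  have w: "w \<ge> 0" by (simp add: w_def)
  have ew: "emeasure lborel W = ennreal w" unfolding w_def
    by (rule emeasure_eq_ennreal_measure) (use emeasure_bounded_finite[of W] W in auto)
  define t where "t = d / (2 * (w + 1))"
  have t: "t > 0" using d w by (simp add: t_def)
  have tw: "t * w \<le> d / 2" using d w by (simp add: t_def field_simps)
  have "measure lborel {x\<in>W. h x = 0} < \<eta> \<or> measure lborel {x\<in>W. h x = 1} < \<eta>"
    if h: "C1_on W h G" and E: "(\<integral>\<^sup>+x\<in>W. ennreal ((norm (G x))\<^sup>2) \<partial>lborel) \<le> ennreal (t * d / 2)" for h G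
  proof (rule ccontr)
    assume neg: "\<not> ?thesis"
    define N where "N x = norm (indicator W x *\<^sub>R G x)" for x
    have [measurable]: "(\<lambda>x. indicator W x *\<^sub>R G x) \<in> borel_measurable borel"
      using W h by (intro borel_measurable_continuous_on_indicator) (auto simp: C1_on_def)
    have [measurable]: "N \<in> borel_measurable borel" unfolding N_def by measurable
    define h0 where "h0 x = indicator W x *\<^sub>R h x" for x
    have [measurable]: "h0 \<in> borel_measurable borel"
      unfolding h0_def using W C1_on_continuous[OF h] by (intro borel_measurable_continuous_on_indicator) auto
    have "(\<integral>\<^sup>+x\<in>W. ennreal (norm (G x)) \<partial>lborel)
       \<le> (\<integral>\<^sup>+x. ennreal t * indicator W x + ennreal (1 / t) * ennreal ((N x)\<^sup>2) \<partial>lborel)"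
    proof (intro nn_integral_mono)
      fix x
      \<comment> \<open>Trades the gradient for its square; the error \<open>t\<close> is integrated over a set of finite measure.\<close>
      have "a \<le> t + 1 / t * a\<^sup>2" if "a \<ge> 0" for a
      proof (cases "a \<le> t")
        case True
        then show ?thesis using t by (simp add: add_increasing2)
      next
        case False
        then have "a * t \<le> a * a" using that by (intro mult_left_mono) auto
        then have "a \<le> 1 / t * a\<^sup>2" using t by (simp add: field_simps power2_eq_square)
        then show ?thesis using t by simp
      qed
      from this[of "norm (G x)"]
      show "ennreal (norm (G x)) * indicator W x \<le> ennreal t * indicator W x + ennreal (1 / t) * ennreal ((N x)\<^sup>2)"
        using t by (auto simp: indicator_def N_def ennreal_mult[symmetric] ennreal_plus[symmetric]
            intro!: ennreal_leI simp del: ennreal_plus)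
    qed
    also have "\<dots> = ennreal t * ennreal w + ennreal (1 / t) * (\<integral>\<^sup>+x. ennreal ((N x)\<^sup>2) \<partial>lborel)"
      by (simp add: nn_integral_add nn_integral_cmult ew)
    also have "(\<integral>\<^sup>+x. ennreal ((N x)\<^sup>2) \<partial>lborel) = (\<integral>\<^sup>+x\<in>W. ennreal ((norm (G x))\<^sup>2) \<partial>lborel)"
      by (intro nn_integral_cong) (auto simp: N_def indicator_def)
    also have "ennreal t * ennreal w + ennreal (1 / t) * \<dots> \<le> ennreal (t * w) + ennreal (1 / t) * ennreal (t * d / 2)"
      using t w by (intro add_mono mult_left_mono E) (auto simp: ennreal_mult)
    also have "\<dots> = ennreal (t * w + d / 2)"
      using t w d by (simp add: ennreal_mult[symmetric] ennreal_plus[symmetric] del: ennreal_plus)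
    also have "\<dots> \<le> ennreal d" using tw by (intro ennreal_leI) simp
    finally obtain a where a: "(\<integral>\<^sup>+x\<in>S. ennreal \<bar>h x - a\<bar> \<partial>lborel) \<le> ennreal (C * d)"
      using CS[OF d h] by blast
    have level: "\<bar>b - a\<bar> * (\<eta> / 2) \<le> C * d" if b: "\<eta> \<le> measure lborel {x\<in>W. h x = b}" for b
    proof -
      let ?Z = "{x\<in>W. h x = b}"
      have "?Z = {x\<in>space borel. x \<in> W \<and> h0 x = b}" by (auto simp: h0_def)
      also have "\<dots> \<in> sets borel" by measurable
      finally have [measurable]: "?Z \<in> sets borel" .
      have "measure lborel ?Z - \<eta> / 2 \<le> measure lborel (?Z \<inter> S)"
        by (rule measure_lborel_Int_ge[of _ W T]) (use S SW W mT in auto)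
      then have Z: "\<eta> / 2 \<le> measure lborel (?Z \<inter> S)" using b by simp
      have "bounded (?Z \<inter> S)" by (rule bounded_subset[OF W(3)]) auto
      then have eZ: "emeasure lborel (?Z \<inter> S) = ennreal (measure lborel (?Z \<inter> S))"
        using emeasure_bounded_finite[of "?Z \<inter> S"] by (intro emeasure_eq_ennreal_measure) auto
      have "ennreal (\<bar>b - a\<bar> * (\<eta> / 2)) \<le> ennreal (\<bar>b - a\<bar> * measure lborel (?Z \<inter> S))"
        using Z by (intro ennreal_leI mult_left_mono) auto
      also have "\<dots> = (\<integral>\<^sup>+x. ennreal \<bar>b - a\<bar> * indicator (?Z \<inter> S) x \<partial>lborel)"
        by (subst nn_integral_cmult_indicator) (auto simp: eZ ennreal_mult)
      also have "\<dots> \<le> (\<integral>\<^sup>+x\<in>S. ennreal \<bar>h x - a\<bar> \<partial>lborel)"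
        by (intro nn_integral_mono) (auto simp: indicator_def)
      finally have "ennreal (\<bar>b - a\<bar> * (\<eta> / 2)) \<le> ennreal (C * d)" using a by simp
      then show ?thesis using C d by (simp add: ennreal_le_iff)
    qed
    have "(\<bar>0 - a\<bar> + \<bar>1 - a\<bar>) * (\<eta> / 2) \<le> 2 * (C * d)"
      using level[of 0] level[of 1] neg by (simp add: algebra_simps)
    moreover have "1 * (\<eta> / 2) \<le> (\<bar>0 - a\<bar> + \<bar>1 - a\<bar>) * (\<eta> / 2)"
      using eta by (intro mult_right_mono) auto
    ultimately show False using C eta by (simp add: d_def)
  qed
  then show ?thesis using t d by (intro exI[of _ "t * d / 2"]) auto
qed

lemma level_set_in_borel:
  fixes h :: "'a::euclidean_space \<Rightarrow> real"
  assumes W: "W \<in> sets borel" and h: "continuous_on W h"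
  shows "{x\<in>W. h x = b} \<in> sets borel"
proof -
  have [measurable]: "W \<in> sets borel" by fact
  have [measurable]: "(\<lambda>x. indicator W x *\<^sub>R h x) \<in> borel_measurable borel"
    by (rule borel_measurable_continuous_on_indicator[OF W h])
  have "{x\<in>W. h x = b} = {x\<in>space borel. x \<in> W \<and> indicator W x *\<^sub>R h x = b}" by auto
  also have "\<dots> \<in> sets borel" by measurable
  finally show ?thesis .
qed

section \<open>Cutoff functions and integral inequalities for a weight of unit mass\<close>

text \<open>
  The simplest \<open>C\<^sup>1\<close> function that is \<open>0\<close> on the left and not on the right; the cutoffs below are built from
  its translates.
\<close>

definition ramp :: "real \<Rightarrow> real" where "ramp t = (max t 0)\<^sup>2"

lemma DERIV_ramp: "(ramp has_real_derivative 2 * max t 0) (at t)"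
proof -
  consider "t < 0" | "t = 0" | "t > 0" by linarith
  then show ?thesis
  proof cases
    case 1
    have "((\<lambda>_. 0) has_real_derivative 0) (at t)" by simp
    then have "(ramp has_real_derivative 0) (at t)"
      by (rule DERIV_cong_ev[THEN iffD1, rotated -1, OF _ refl])
        (use 1 in \<open>auto simp: ramp_def intro!: eventually_mono[OF eventually_nhds_in_open[of "{..<0}" t]]\<close>)
    then show ?thesis using 1 by simp
  next
    case 3
    have "((\<lambda>t. t\<^sup>2) has_real_derivative 2 * t) (at t)" by (auto intro!: derivative_eq_intros)
    then have "(ramp has_real_derivative 2 * t) (at t)"
      by (rule DERIV_cong_ev[THEN iffD1, rotated -1, OF _ refl])
        (use 3 in \<open>auto simp: ramp_def intro!: eventually_mono[OF eventually_nhds_in_open[of "{0<..}" t]]\<close>)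
    then show ?thesis using 3 by simp
  next
    case 2
    have "((\<lambda>h. ramp h / h) \<longlongrightarrow> 0) (at 0)"
    proof (rule Lim_null_comparison)
      show "eventually (\<lambda>h. norm (ramp h / h) \<le> \<bar>h\<bar>) (at 0)"
        by (auto simp: ramp_def max_def power2_eq_square)
      show "((\<lambda>h::real. \<bar>h\<bar>) \<longlongrightarrow> 0) (at 0)"
        by (rule tendsto_rabs_zero) (rule tendsto_ident_at)
    qed
    then show ?thesis using 2 by (simp add: DERIV_def ramp_def)
  qed
qed

lemma ex_C1_truncation:
  fixes k :: real
  assumes k: "0 < k"
  shows "\<exists>\<phi> \<phi>'. (\<forall>t. (\<phi> has_real_derivative \<phi>' t) (at t)) \<and> continuous_on UNIV \<phi>' \<and> (\<forall>t. \<bar>\<phi>' t\<bar> \<le> 1) \<and>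
     (\<forall>t\<le>k. \<phi> t = t) \<and> (\<forall>t. \<phi> t \<le> t) \<and> (\<forall>t\<ge>k. k \<le> \<phi> t) \<and> (\<forall>t\<ge>2 * k. \<phi> t = \<phi> (2 * k) \<and> \<phi>' t = 0)"
proof -
  define \<phi> where "\<phi> t = t - (ramp (t - k) - ramp (t - 2 * k)) / (2 * k)" for t
  define \<phi>' where "\<phi>' t = 1 - (max (t - k) 0 - max (t - 2 * k) 0) / k" for t
  have "(\<phi> has_real_derivative \<phi>' t) (at t)" for t
    unfolding \<phi>_def \<phi>'_def using k
    by (auto intro!: derivative_eq_intros DERIV_chain2[OF DERIV_ramp] simp: field_simps)
  moreover have "continuous_on UNIV \<phi>'" unfolding \<phi>'_def by (intro continuous_intros) (use k in auto)
  moreover have "\<bar>\<phi>' t\<bar> \<le> 1" for t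
    using k by (auto simp: \<phi>'_def max_def field_simps abs_le_iff)
  moreover have "\<phi> t = t" if "t \<le> k" for t using that k by (simp add: \<phi>_def ramp_def)
  moreover have top: "\<phi> t = 3 * k / 2" if "t \<ge> 2 * k" for t
    using that k by (simp add: \<phi>_def ramp_def max_def field_simps power2_eq_square)
  moreover have "\<phi> t = \<phi> (2 * k)" if "t \<ge> 2 * k" for t
    by (simp only: top[OF that] top[OF order_refl])
  moreover have "\<phi> t \<le> t" for t
    using k by (auto simp: \<phi>_def ramp_def intro!: divide_nonneg_pos power_mono)
  moreover have "k \<le> \<phi> t" if "t \<ge> k" for t
  proof (cases "t \<ge> 2 * k")
    case False
    then have "(t - k) * (t - k) \<le> (t - k) * k" using that by (intro mult_left_mono) auto
    then have "(t - k)\<^sup>2 / (2 * k) \<le> (t - k) / 2" using k by (simp add: field_simps power2_eq_square)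
    then show ?thesis using that False k by (simp add: \<phi>_def ramp_def)
  next
    case True
    then show ?thesis using top[OF True] k by simp
  qed
  moreover have "\<phi>' t = 0" if "t \<ge> 2 * k" for t using that k by (simp add: \<phi>'_def max_def)
  ultimately show ?thesis by - (rule exI[where x = \<phi>], rule exI[where x = \<phi>'], blast)
qed

lemma ex_C1_step:
  fixes e :: real
  assumes e: "0 < e"
  shows "\<exists>\<theta> \<theta>'. (\<forall>t. (\<theta> has_real_derivative \<theta>' t) (at t)) \<and> continuous_on UNIV \<theta>' \<and> (\<forall>t. \<bar>\<theta>' t\<bar> \<le> 2 / e) \<and>
     (\<forall>t. 0 \<le> \<theta> t \<and> \<theta> t \<le> 1) \<and> (\<forall>t\<le>e. \<theta> t = 0) \<and> (\<forall>t\<ge>2 * e. \<theta> t = 1 \<and> \<theta>' t = 0)"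
proof -
  define \<theta> where "\<theta> t = 2 / e\<^sup>2 * (ramp (t - e) - 2 * ramp (t - 3 / 2 * e) + ramp (t - 2 * e))" for t
  define \<theta>' where "\<theta>' t = 4 / e\<^sup>2 * (max (t - e) 0 - 2 * max (t - 3 / 2 * e) 0 + max (t - 2 * e) 0)" for t
  have der: "(\<theta> has_real_derivative \<theta>' t) (at t)" for t
    unfolding \<theta>_def \<theta>'_def using e
    by (auto intro!: derivative_eq_intros DERIV_chain2[OF DERIV_ramp] simp: field_simps)
  moreover have "continuous_on UNIV \<theta>'" unfolding \<theta>'_def by (intro continuous_intros)
  moreover have pos: "0 \<le> \<theta>' t" for t
    unfolding \<theta>'_def using e by (intro mult_nonneg_nonneg) (auto simp: max_def)
  moreover have "\<theta>' t \<le> 2 / e" for t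
  proof -
    have "4 / e\<^sup>2 * (max (t - e) 0 - 2 * max (t - 3 / 2 * e) 0 + max (t - 2 * e) 0) \<le> 4 / e\<^sup>2 * (e / 2)"
      using e by (intro mult_left_mono) (auto simp: max_def)
    then show ?thesis using e by (simp add: \<theta>'_def power2_eq_square)
  qed
  moreover have low: "\<theta> t = 0" if "t \<le> e" for t using that e by (simp add: \<theta>_def ramp_def)
  moreover have top: "\<theta> t = 1" if "t \<ge> 2 * e" for t
    using that e by (simp add: \<theta>_def ramp_def max_def field_simps power2_eq_square)
  moreover have mono: "\<theta> s \<le> \<theta> t" if "s \<le> t" for s t
    by (rule DERIV_nonneg_imp_nondecreasing[OF that]) (use der pos in blast)
  moreover have "0 \<le> \<theta> t" for t using mono[of "min t e" t] low[of "min t e"] by auto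
  moreover have "\<theta> t \<le> 1" for t using mono[of t "max t (2 * e)"] top[of "max t (2 * e)"] by auto
  moreover have "\<theta>' t = 0" if "t \<ge> 2 * e" for t using that e by (simp add: \<theta>'_def max_def)
  ultimately show ?thesis by - (rule exI[where x = \<theta>], rule exI[where x = \<theta>'], simp)
qed

lemma weighted_variance:
  fixes u g :: "'b \<Rightarrow> real"
  assumes iu: "integrable M u" and ig: "integrable M (\<lambda>x. u x * g x)"
    and ig2: "integrable M (\<lambda>x. u x * (g x)\<^sup>2)" and mass: "(LINT x|M. u x) = 1"
  shows "(LINT x|M. u x * (g x - a)\<^sup>2) = (LINT x|M. u x * (g x)\<^sup>2) - 2 * a * (LINT x|M. u x * g x) + a\<^sup>2"
    and "integrable M (\<lambda>x. u x * (g x - a)\<^sup>2)"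
proof -
  have eq: "u x * (g x - a)\<^sup>2 = u x * (g x)\<^sup>2 - 2 * a * (u x * g x) + a\<^sup>2 * u x" for x
    by (simp add: power2_eq_square algebra_simps)
  show "(LINT x|M. u x * (g x - a)\<^sup>2) = (LINT x|M. u x * (g x)\<^sup>2) - 2 * a * (LINT x|M. u x * g x) + a\<^sup>2"
    unfolding eq using assms by simp
  show "integrable M (\<lambda>x. u x * (g x - a)\<^sup>2)"
    unfolding eq using assms by simp
qed

lemma weighted_mean_deviation_le:
  fixes u g :: "'b \<Rightarrow> real"
  assumes iu: "integrable M u" and ig: "integrable M (\<lambda>x. u x * g x)"
    and ig2: "integrable M (\<lambda>x. u x * (g x)\<^sup>2)" and mass: "(LINT x|M. u x) = 1"
    and u0: "\<And>x. x \<in> space M \<Longrightarrow> 0 \<le> u x"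
  shows "(LINT x|M. u x * \<bar>g x - a\<bar>)\<^sup>2 \<le> (LINT x|M. u x * (g x - a)\<^sup>2)"
    and "integrable M (\<lambda>x. u x * \<bar>g x - a\<bar>)"
proof -
  let ?k = "\<lambda>x. \<bar>g x - a\<bar>"
  have "integrable M (\<lambda>x. \<bar>u x * (g x - a)\<bar>)"
    using iu ig by (intro integrable_abs) (simp add: right_diff_distrib)
  then show ik: "integrable M (\<lambda>x. u x * ?k x)"
    by (rule Bochner_Integration.integrable_cong[THEN iffD1, rotated -1]) (use u0 in \<open>auto simp: abs_mult\<close>)
  define r where "r = (LINT x|M. u x * ?k x)"
  have ik2: "integrable M (\<lambda>x. u x * (?k x)\<^sup>2)" using weighted_variance(2)[OF iu ig ig2 mass] by simp
  have "0 \<le> (LINT x|M. u x * (?k x - r)\<^sup>2)"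
    by (intro integral_nonneg_AE AE_I2 mult_nonneg_nonneg u0) auto
  also have "\<dots> = (LINT x|M. u x * (?k x)\<^sup>2) - r\<^sup>2"
    using weighted_variance(1)[OF iu ik ik2 mass, of r] by (simp add: r_def power2_eq_square)
  finally show "(LINT x|M. u x * ?k x)\<^sup>2 \<le> (LINT x|M. u x * (g x - a)\<^sup>2)" by (simp add: r_def)
qed

text \<open>
  Where \<open>u > s0\<close> write \<open>m - u = b g\<close>. Then \<open>b \<gamma> = (m - u) - b (g - \<gamma>)\<close>, where \<open>b\<close> is at most a multiple of \<open>u\<close>,
  and bounded below where \<open>u \<le> R\<close>. Integrating this against the sign of \<open>\<gamma>\<close>, the term \<open>m - u\<close>
  disappears because both masses are \<open>1\<close>.
\<close>

lemma mean_le_of_equal_mass: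
  fixes u m g :: "'b \<Rightarrow> real"
  assumes fin: "finite_measure M"
    and iu: "integrable M u" and im: "integrable M m"
    and ig: "integrable M (\<lambda>x. u x * g x)" and ig2: "integrable M (\<lambda>x. u x * (g x)\<^sup>2)"
    and mass: "(LINT x|M. u x) = 1" "(LINT x|M. m x) = 1"
    and u0: "\<And>x. x \<in> space M \<Longrightarrow> 0 \<le> u x"
    and slope: "\<And>x. x \<in> space M \<Longrightarrow> s0 < u x \<Longrightarrow>
        \<exists>b\<ge>0. m x - u x = b * g x \<and> b \<le> B * u x \<and> (u x \<le> R \<longrightarrow> \<beta> \<le> b)"
    and low: "\<And>x. x \<in> space M \<Longrightarrow> u x \<le> s0 \<Longrightarrow> \<bar>m x - u x\<bar> \<le> K"
    and pos: "0 \<le> B" "0 \<le> \<beta>" "0 \<le> K"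
  defines "\<gamma> \<equiv> LINT x|M. u x * g x"
  shows "\<beta> * \<bar>\<gamma>\<bar> * measure M {x\<in>space M. s0 < u x \<and> u x \<le> R}
     \<le> B * (LINT x|M. u x * \<bar>g x - \<gamma>\<bar>) + K * measure M {x\<in>space M. u x \<le> s0}"
proof -
  interpret finite_measure M by fact
  have [measurable]: "u \<in> borel_measurable M" using iu by auto
  let ?A = "{x\<in>space M. s0 < u x \<and> u x \<le> R}" and ?L = "{x\<in>space M. u x \<le> s0}"
  have [measurable]: "?A \<in> sets M" "?L \<in> sets M" by measurable
  have iA: "integrable M (indicator A :: 'b \<Rightarrow> real)" if "A \<in> sets M" for A
    by (rule integrable_real_indicator) (use that emeasure_finite[of A] in \<open>auto simp: less_top[symmetric]\<close>)
  have ik: "integrable M (\<lambda>x. u x * \<bar>g x - \<gamma>\<bar>)"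
    using weighted_mean_deviation_le(2)[OF iu ig ig2 mass(1) u0] .
  have "\<beta> * \<bar>\<gamma>\<bar> * measure M ?A = (LINT x|M. \<beta> * \<bar>\<gamma>\<bar> * indicator ?A x)" by simp
  also have "\<dots> \<le> (LINT x|M. sgn \<gamma> * (m x - u x) + B * (u x * \<bar>g x - \<gamma>\<bar>) + K * indicator ?L x)"
  proof (rule integral_mono)
    fix x assume x: "x \<in> space M"
    show "\<beta> * \<bar>\<gamma>\<bar> * indicator ?A x \<le> sgn \<gamma> * (m x - u x) + B * (u x * \<bar>g x - \<gamma>\<bar>) + K * indicator ?L x"
    proof (cases "u x \<le> s0")
      case True
      have "- K \<le> sgn \<gamma> * (m x - u x)" using low[OF x True] pos by (auto simp: sgn_real_def)
      moreover have "0 \<le> B * (u x * \<bar>g x - \<gamma>\<bar>)" using pos u0[OF x] by simp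
      ultimately show ?thesis using True x by simp
    next
      case False
      then obtain b where b: "b \<ge> 0" "m x - u x = b * g x" "b \<le> B * u x" "u x \<le> R \<longrightarrow> \<beta> \<le> b"
        using slope[OF x] by auto
      have "\<beta> * \<bar>\<gamma>\<bar> * indicator ?A x \<le> b * \<bar>\<gamma>\<bar>"
        using b by (auto simp: indicator_def mult_right_mono)
      also have "\<dots> = sgn \<gamma> * (m x - u x) - sgn \<gamma> * b * (g x - \<gamma>)"
        unfolding b(2) using abs_sgn[of \<gamma>] by (simp add: algebra_simps)
      also have "\<dots> \<le> sgn \<gamma> * (m x - u x) + b * \<bar>g x - \<gamma>\<bar>"
      proof -
        have "- (sgn \<gamma> * (g x - \<gamma>)) \<le> \<bar>g x - \<gamma>\<bar>" by (auto simp: sgn_real_def)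
        from mult_left_mono[OF this b(1)] show ?thesis by (simp add: algebra_simps)
      qed
      also have "b * \<bar>g x - \<gamma>\<bar> \<le> B * (u x * \<bar>g x - \<gamma>\<bar>)"
        using mult_right_mono[OF b(3), of "\<bar>g x - \<gamma>\<bar>"] by (simp add: mult_ac)
      finally show ?thesis using False by simp
    qed
  qed (use iu im ik iA in auto)
  also have "\<dots> = B * (LINT x|M. u x * \<bar>g x - \<gamma>\<bar>) + K * measure M ?L"
    using iu im ik iA mass by simp
  finally show ?thesis .
qed

text \<open>
  The estimate of the mean is squared. Its contribution from \<open>{u \<le> s0}\<close> stays linear in the measure of that
  set, since this measure is at most \<open>T\<close>.
\<close>

lemma energy_le_variance_plus_low_set:
  fixes u m g :: "'b \<Rightarrow> real"
  assumes fin: "finite_measure M" and T: "measure M (space M) \<le> T"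
    and iu: "integrable M u" and im: "integrable M m"
    and ig: "integrable M (\<lambda>x. u x * g x)" and ig2: "integrable M (\<lambda>x. u x * (g x)\<^sup>2)"
    and mass: "(LINT x|M. u x) = 1" "(LINT x|M. m x) = 1"
    and u0: "\<And>x. x \<in> space M \<Longrightarrow> 0 \<le> u x"
    and slope: "\<And>x. x \<in> space M \<Longrightarrow> s0 < u x \<Longrightarrow>
        \<exists>b\<ge>0. m x - u x = b * g x \<and> b \<le> B * u x \<and> (u x \<le> R \<longrightarrow> \<beta> \<le> b)"
    and low: "\<And>x. x \<in> space M \<Longrightarrow> u x \<le> s0 \<Longrightarrow> \<bar>m x - u x\<bar> \<le> K"
    and pos: "0 \<le> B" "0 < \<beta>" "0 \<le> K" "0 < q" "0 \<le> D" "0 \<le> K'"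
    and q: "q \<le> measure M {x\<in>space M. s0 < u x \<and> u x \<le> R}"
    and E1: "\<And>x. x \<in> space M \<Longrightarrow> s0 < u x \<Longrightarrow> e x \<le> D * (u x * (g x)\<^sup>2)"
    and E2: "\<And>x. x \<in> space M \<Longrightarrow> u x \<le> s0 \<Longrightarrow> e x \<le> K'"
  defines "\<gamma> \<equiv> LINT x|M. u x * g x"
  shows "(\<integral>\<^sup>+x. ennreal (e x) \<partial>M) \<le> ennreal
     (D * (1 + 2 * B\<^sup>2 / (\<beta> * q)\<^sup>2) * (LINT x|M. u x * (g x - \<gamma>)\<^sup>2)
      + (K' + D * (2 * K\<^sup>2 * T / (\<beta> * q)\<^sup>2)) * measure M {x\<in>space M. u x \<le> s0})"
proof -
  interpret finite_measure M by fact
  have [measurable]: "u \<in> borel_measurable M" using iu by auto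
  let ?L = "{x\<in>space M. u x \<le> s0}"
  have [measurable]: "?L \<in> sets M" by measurable
  have iL: "integrable M (indicator ?L :: 'b \<Rightarrow> real)"
    by (rule integrable_real_indicator) (use emeasure_finite[of ?L] in \<open>auto simp: less_top[symmetric]\<close>)
  define V where "V = (LINT x|M. u x * (g x - \<gamma>)\<^sup>2)"
  define P where "P = measure M ?L"
  define Y where "Y = (LINT x|M. u x * \<bar>g x - \<gamma>\<bar>)"
  define Q where "Q = \<beta> * q"
  have Q: "Q > 0" using pos by (simp add: Q_def)
  have P: "0 \<le> P" "P \<le> T" using T bounded_measure[of ?L] by (auto simp: P_def)
  have Y0: "0 \<le> Y" unfolding Y_def by (intro integral_nonneg_AE AE_I2 mult_nonneg_nonneg u0) auto
  have YV: "Y\<^sup>2 \<le> V" unfolding Y_def V_def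
    by (rule weighted_mean_deviation_le(1)[OF iu ig ig2 mass(1) u0])
  have "Q * \<bar>\<gamma>\<bar> \<le> \<beta> * \<bar>\<gamma>\<bar> * measure M {x\<in>space M. s0 < u x \<and> u x \<le> R}"
    using mult_left_mono[OF q, of "\<beta> * \<bar>\<gamma>\<bar>"] pos by (simp add: Q_def mult_ac)
  also have "\<dots> \<le> B * Y + K * P" unfolding Y_def P_def \<gamma>_def
    by (rule mean_le_of_equal_mass[OF fin iu im ig ig2 mass u0 slope low]) (use pos in auto)
  finally have "(Q * \<bar>\<gamma>\<bar>)\<^sup>2 \<le> (B * Y + K * P)\<^sup>2"
    using Q by (intro power_mono) auto
  also have "\<dots> \<le> 2 * (B * Y)\<^sup>2 + 2 * (K * P)\<^sup>2"
    using sum_squares_bound[of "B * Y" "K * P"] by (simp add: power2_sum)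
  also have "\<dots> \<le> 2 * (B\<^sup>2 * V) + 2 * (K\<^sup>2 * (T * P))"
    using YV P
    by (intro add_mono mult_left_mono) (auto simp: power_mult_distrib intro!: mult_left_mono,
        simp add: power2_eq_square mult_right_mono)
  finally have gam: "\<gamma>\<^sup>2 \<le> 2 * B\<^sup>2 / Q\<^sup>2 * V + 2 * K\<^sup>2 * T / Q\<^sup>2 * P"
    using Q by (simp add: power_mult_distrib field_simps)
  have V: "(LINT x|M. u x * (g x)\<^sup>2) = V + \<gamma>\<^sup>2"
    unfolding V_def using weighted_variance(1)[OF iu ig ig2 mass(1), of \<gamma>]
    by (simp add: \<gamma>_def power2_eq_square)
  have nn: "0 \<le> D * (u x * (g x)\<^sup>2) + K' * indicator ?L x" if "x \<in> space M" for x
    using u0[OF that] pos by (auto intro!: add_nonneg_nonneg)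
  have "(\<integral>\<^sup>+x. ennreal (e x) \<partial>M) \<le> (\<integral>\<^sup>+x. ennreal (D * (u x * (g x)\<^sup>2) + K' * indicator ?L x) \<partial>M)"
  proof (intro nn_integral_mono ennreal_leI)
    fix x assume x: "x \<in> space M"
    show "e x \<le> D * (u x * (g x)\<^sup>2) + K' * indicator ?L x"
    proof (cases "u x \<le> s0")
      case True
      moreover have "0 \<le> D * (u x * (g x)\<^sup>2)" using u0[OF x] pos by simp
      ultimately show ?thesis using E2[OF x True] x by simp
    next
      case False then show ?thesis using E1[OF x] by simp
    qed
  qed
  also have "\<dots> = ennreal (LINT x|M. D * (u x * (g x)\<^sup>2) + K' * indicator ?L x)"
    by (rule nn_integral_eq_integral) (use ig2 iL nn in auto)
  also have "(LINT x|M. D * (u x * (g x)\<^sup>2) + K' * indicator ?L x) = D * (V + \<gamma>\<^sup>2) + K' * P"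
    using ig2 iL by (simp add: V P_def)
  also have "\<dots> \<le> D * (V + (2 * B\<^sup>2 / Q\<^sup>2 * V + 2 * K\<^sup>2 * T / Q\<^sup>2 * P)) + K' * P"
    using gam pos by (intro add_mono mult_left_mono) auto
  also have "\<dots> = D * (1 + 2 * B\<^sup>2 / Q\<^sup>2) * V + (K' + D * (2 * K\<^sup>2 * T / Q\<^sup>2)) * P"
    by (simp add: algebra_simps)
  finally show ?thesis unfolding V_def P_def Q_def by (simp add: ennreal_leI)
qed

lemma weighted_integral_diff_le:
  fixes u m k :: "'b \<Rightarrow> real"
  assumes iu: "integrable M u" and im: "integrable M m"
    and k: "k \<in> borel_measurable M" "\<And>x. x \<in> space M \<Longrightarrow> \<bar>k x\<bar> \<le> B"
  shows "\<bar>(LINT x|M. u x * k x) - (LINT x|M. m x * k x)\<bar> \<le> B * (LINT x|M. \<bar>u x - m x\<bar>)"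
    and "integrable M (\<lambda>x. u x * k x)"
proof -
  note [measurable] = k(1)
  have i: "integrable M (\<lambda>x. v x * k x)" if "integrable M v" for v :: "'b \<Rightarrow> real"
  proof (rule Bochner_Integration.integrable_bound[of M "\<lambda>x. B * v x"])
    show "AE x in M. norm (v x * k x) \<le> norm (B * v x)"
    proof (rule AE_I2)
      fix x assume "x \<in> space M"
      then have "\<bar>k x\<bar> \<le> \<bar>B\<bar>" using k(2) by fastforce
      then show "norm (v x * k x) \<le> norm (B * v x)"
        by (simp add: abs_mult mult.commute[of "\<bar>v x\<bar>"] mult_right_mono)
    qed
  qed (use that in auto)
  show "integrable M (\<lambda>x. u x * k x)" by (rule i[OF iu])
  have "(LINT x|M. u x * k x) - (LINT x|M. m x * k x) = (LINT x|M. (u x - m x) * k x)"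
    using i[OF iu] i[OF im] by (simp add: left_diff_distrib)
  also have "\<bar>\<dots>\<bar> \<le> (LINT x|M. B * \<bar>u x - m x\<bar>)"
  proof -
    have "norm (LINT x|M. (u x - m x) * k x) \<le> (LINT x|M. norm ((u x - m x) * k x))"
      by (rule integral_norm_bound)
    also have "\<dots> \<le> (LINT x|M. B * \<bar>u x - m x\<bar>)"
    proof (rule integral_mono)
      show "integrable M (\<lambda>x. norm ((u x - m x) * k x))" by (intro integrable_norm i) (use iu im in auto)
      show "norm ((u x - m x) * k x) \<le> B * \<bar>u x - m x\<bar>" if "x \<in> space M" for x
        using mult_left_mono[OF k(2)[OF that], of "\<bar>u x - m x\<bar>"] by (simp add: abs_mult mult.commute)
    qed (use iu im in auto)
    finally show ?thesis by simp
  qed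
  finally show "\<bar>(LINT x|M. u x * k x) - (LINT x|M. m x * k x)\<bar> \<le> B * (LINT x|M. \<bar>u x - m x\<bar>)" by simp
qed

text \<open>
  For a fixed bounded test function all integrals in the inequality are continuous in the weight with
  respect to \<open>L\<^sup>1\<close> convergence.
\<close>

lemma weighted_Poincare_L1_limit:
  fixes m h N :: "'b \<Rightarrow> real" and U :: "('b \<Rightarrow> real) set"
  assumes fin: "finite_measure M"
    and iU: "\<And>u. u \<in> U \<Longrightarrow> integrable M u" "\<And>u. u \<in> U \<Longrightarrow> (LINT x|M. u x) = 1"
    and im: "integrable M m" "(LINT x|M. m x) = 1"
    and h: "h \<in> borel_measurable M" "\<And>x. x \<in> space M \<Longrightarrow> \<bar>h x\<bar> \<le> B"
    and N: "N \<in> borel_measurable M" "\<And>x. x \<in> space M \<Longrightarrow> \<bar>N x\<bar> \<le> B'"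
    and approx: "\<And>\<eta>. \<eta> > 0 \<Longrightarrow> \<exists>u\<in>U. (LINT x|M. \<bar>u x - m x\<bar>) < \<eta>"
    and P: "\<And>u. u \<in> U \<Longrightarrow> (LINT x|M. u x * (h x - (LINT y|M. u y * h y))\<^sup>2) \<le> c * (LINT x|M. u x * N x)"
  shows "(LINT x|M. m x * (h x - (LINT y|M. m y * h y))\<^sup>2) \<le> c * (LINT x|M. m x * N x)"
proof -
  interpret finite_measure M by fact
  have "\<exists>v. v \<in> U \<and> (LINT x|M. \<bar>v x - m x\<bar>) < 1 / Suc n" for n
    using approx[of "1 / Suc n"] by auto
  then obtain u where u: "\<And>n. u n \<in> U" "\<And>n. (LINT x|M. \<bar>u n x - m x\<bar>) < 1 / Suc n" by metis
  have L1: "(\<lambda>n. LINT x|M. \<bar>u n x - m x\<bar>) \<longlonglongrightarrow> 0"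
  proof (rule Lim_null_comparison)
    show "\<forall>\<^sub>F n in sequentially. norm (LINT x|M. \<bar>u n x - m x\<bar>) \<le> inverse (Suc n)"
      using u(2) by (auto simp: inverse_eq_divide intro!: less_imp_le always_eventually)
    show "(\<lambda>n. inverse (real (Suc n))) \<longlonglongrightarrow> 0" by (rule LIMSEQ_inverse_real_of_nat)
  qed
  have lim: "(\<lambda>n. LINT x|M. u n x * k x) \<longlonglongrightarrow> (LINT x|M. m x * k x)"
    if k: "k \<in> borel_measurable M" "\<And>x. x \<in> space M \<Longrightarrow> \<bar>k x\<bar> \<le> b" for k b
  proof -
    have "(\<lambda>n. (LINT x|M. u n x * k x) - (LINT x|M. m x * k x)) \<longlonglongrightarrow> 0"
    proof (rule Lim_null_comparison)
      show "\<forall>\<^sub>F n in sequentially. norm ((LINT x|M. u n x * k x) - (LINT x|M. m x * k x))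
          \<le> b * (LINT x|M. \<bar>u n x - m x\<bar>)"
        using weighted_integral_diff_le(1)[OF iU(1)[OF u(1)] im(1) k] by simp
      show "(\<lambda>n. b * (LINT x|M. \<bar>u n x - m x\<bar>)) \<longlonglongrightarrow> 0"
        by (rule tendsto_mult_right_zero) (rule L1)
    qed
    then show ?thesis by (simp add: LIM_zero_iff)
  qed
  have h2: "(\<lambda>x. (h x)\<^sup>2) \<in> borel_measurable M" "\<And>x. x \<in> space M \<Longrightarrow> \<bar>(h x)\<^sup>2\<bar> \<le> B\<^sup>2"
    using h abs_le_square_iff[of "h _" B] by (auto intro: order_trans[OF _ abs_ge_self])
  have var: "(LINT x|M. v x * (h x - (LINT y|M. v y * h y))\<^sup>2) = (LINT x|M. v x * (h x)\<^sup>2) - (LINT x|M. v x * h x)\<^sup>2"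
    if "integrable M v" "(LINT x|M. v x) = 1" for v
    using weighted_variance(1)[OF that(1) weighted_integral_diff_le(2)[OF that(1,1) h]
        weighted_integral_diff_le(2)[OF that(1,1) h2] that(2), of "LINT y|M. v y * h y"]
    by (simp add: power2_eq_square)
  have "(\<lambda>n. (LINT x|M. u n x * (h x)\<^sup>2) - (LINT x|M. u n x * h x)\<^sup>2)
      \<longlonglongrightarrow> (LINT x|M. m x * (h x)\<^sup>2) - (LINT x|M. m x * h x)\<^sup>2"
    by (intro tendsto_diff tendsto_power lim[OF h2] lim[OF h])
  moreover have "(\<lambda>n. c * (LINT x|M. u n x * N x)) \<longlonglongrightarrow> c * (LINT x|M. m x * N x)"
    by (intro tendsto_mult_left lim[OF N])
  ultimately have "(LINT x|M. m x * (h x)\<^sup>2) - (LINT x|M. m x * h x)\<^sup>2 \<le> c * (LINT x|M. m x * N x)"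
    by (rule LIMSEQ_le) (use P[OF u(1)] var[OF iU[OF u(1)]] in auto)
  then show ?thesis using var[OF im] by simp
qed

text \<open>
  Applied to a majorant \<open>F\<close> whose measurability is unclear, as it involves the gradient of \<open>f(x, u(x))\<close> where
  \<open>u\<close> vanishes. The constant is therefore moved out of the integral on the side of \<open>k\<close>.
\<close>

lemma nn_integral_le_cmult:
  fixes k :: "'b \<Rightarrow> real"
  assumes k[measurable]: "k \<in> borel_measurable M" and c: "0 < c"
    and le: "\<And>x. x \<in> space M \<Longrightarrow> ennreal (k x) \<le> ennreal c * F x"
  shows "(\<integral>\<^sup>+x. ennreal (k x) \<partial>M) \<le> ennreal c * (\<integral>\<^sup>+x. F x \<partial>M)"
proof -
  have inv: "ennreal (1 / c) * (ennreal c * y) = y" "ennreal c * (ennreal (1 / c) * y) = y" for y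
    using c by (simp_all add: mult.assoc[symmetric] ennreal_mult[symmetric])
  have "(\<integral>\<^sup>+x. ennreal (k x) \<partial>M) = (\<integral>\<^sup>+x. ennreal c * (ennreal (1 / c) * ennreal (k x)) \<partial>M)"
    by (simp add: inv)
  also have "\<dots> = ennreal c * (\<integral>\<^sup>+x. ennreal (1 / c) * ennreal (k x) \<partial>M)"
    by (rule nn_integral_cmult) measurable
  also have "\<dots> \<le> ennreal c * (\<integral>\<^sup>+x. F x \<partial>M)"
  proof (intro mult_left_mono nn_integral_mono)
    fix x assume "x \<in> space M"
    then have "ennreal (1 / c) * ennreal (k x) \<le> ennreal (1 / c) * (ennreal c * F x)"
      by (intro mult_left_mono le) auto
    then show "ennreal (1 / c) * ennreal (k x) \<le> F x" by (simp only: inv)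
  qed simp
  finally show ?thesis .
qed

section \<open>The flat torus, bounded domains and their cells\<close>

lemma descends_int_shift:
  assumes g: "descends Torus g" and b: "b \<in> Basis"
  shows "g (x + of_int n *\<^sub>R b) = g x"
proof -
  have step: "g (y + b) = g y" for y using g b by simp
  show ?thesis
  proof (induction n rule: int_induct[where k = 0])
    case (step1 i)
    have "x + of_int (i + 1) *\<^sub>R b = x + of_int i *\<^sub>R b + b" by (simp add: scaleR_left_distrib)
    then show ?case using step[of "x + of_int i *\<^sub>R b"] step1(2) by metis
  next
    case (step2 i)
    have "x + of_int i *\<^sub>R b = x + of_int (i - 1) *\<^sub>R b + b" by (simp add: scaleR_left_diff_distrib)
    then show ?case using step[of "x + of_int (i - 1) *\<^sub>R b"] step2(2) by metis
  qed simp
qed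

lemma descends_lattice_shift:
  assumes g: "descends Torus g" and F: "finite F" "F \<subseteq> Basis"
  shows "g (x + (\<Sum>b\<in>F. of_int (n b) *\<^sub>R b)) = g x"
  using F
proof (induction F rule: finite_induct)
  case (insert b F)
  have "g (x + (\<Sum>b\<in>insert b F. of_int (n b) *\<^sub>R b)) = g (x + (\<Sum>b\<in>F. of_int (n b) *\<^sub>R b) + of_int (n b) *\<^sub>R b)"
    using insert(1,2) by (simp add: add_ac)
  also have "\<dots> = g (x + (\<Sum>b\<in>F. of_int (n b) *\<^sub>R b))"
    by (rule descends_int_shift[OF g]) (use insert in auto)
  also have "\<dots> = g x" using insert by auto
  finally show ?case .
qed simp

text \<open>
  On the torus \<open>bar Torus\<close> is the whole space; extrema over it are extrema over the closed unit cube, by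
  periodicity.
\<close>

fun representatives :: "'a::euclidean_space spatial \<Rightarrow> 'a set" where
  "representatives (Domain W) = closure W"
| "representatives Torus = cbox 0 One"

lemma representatives:
  assumes "admissible X"
  shows "compact (representatives X)" "representatives X \<subseteq> bar X" "cell X \<subseteq> representatives X"
    "representatives X \<noteq> {}"
proof -
  show "compact (representatives X)" using assms by (cases X) (auto simp: compact_closure)
  show "representatives X \<subseteq> bar X" by (cases X) auto
  show "cell X \<subseteq> representatives X"
    using closure_subset by (cases X) (auto simp: mem_box less_imp_le)
  show "representatives X \<noteq> {}" using assms by (cases X) (auto simp: box_ne_empty)
qed

lemma ex_representative:
  fixes x :: "'a::euclidean_space"
  assumes "x \<in> bar X"
  shows "\<exists>y\<in>representatives X. \<forall>g :: 'a \<Rightarrow> 'b. descends X g \<longrightarrow> g x = g y"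
proof (cases X)
  case (Domain W)
  then show ?thesis using assms by auto
next
  case Torus
  let ?y = "\<Sum>b\<in>Basis. frac (x \<bullet> b) *\<^sub>R b"
  have "?y + (\<Sum>b\<in>Basis. of_int \<lfloor>x \<bullet> b\<rfloor> *\<^sub>R b) = (\<Sum>b\<in>Basis. (x \<bullet> b) *\<^sub>R b)"
    by (simp add: sum.distrib[symmetric] frac_def scaleR_left_distrib[symmetric])
  then have x: "?y + (\<Sum>b\<in>Basis. of_int \<lfloor>x \<bullet> b\<rfloor> *\<^sub>R b) = x"
    by (simp add: euclidean_representation)
  have "?y \<in> cbox 0 One" by (simp add: mem_box frac_ge_0 less_imp_le[OF frac_lt_1])
  moreover have "g x = g ?y" if "descends Torus g" for g :: "'a \<Rightarrow> 'b"
  proof -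
    have "g (?y + (\<Sum>b\<in>Basis. of_int \<lfloor>x \<bullet> b\<rfloor> *\<^sub>R b)) = g ?y"
      by (rule descends_lattice_shift[OF that]) auto
    then show ?thesis unfolding x .
  qed
  ultimately show ?thesis using Torus by (intro bexI[of _ ?y]) auto
qed

lemma open_pts: "admissible X \<Longrightarrow> open (pts X)"
  by (cases X) auto

lemma pts_subset_bar: "pts X \<subseteq> bar X"
  using closure_subset by (cases X) auto

lemma cell_subset_pts: "cell X \<subseteq> pts X"
  by (cases X) auto

text \<open>
  A connected open set that fills the cell up to a null set. The results on \<open>C1_on\<close> functions are applied
  to it.
\<close>

fun open_cell :: "'a::euclidean_space spatial \<Rightarrow> 'a set" where
  "open_cell (Domain W) = W"
| "open_cell Torus = box 0 One"

lemma open_cell: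
  fixes X :: "'a::euclidean_space spatial"
  assumes "admissible X"
  shows "open (open_cell X)" "connected (open_cell X)" "bounded (open_cell X)" "open_cell X \<subseteq> cell X"
proof -
  show "open (open_cell X)" using assms by (cases X) (simp_all add: open_box)
  show "bounded (open_cell X)" using assms by (cases X) (simp_all add: bounded_box)
  have "connected (box 0 (One::'a))" by (intro convex_connected convex_box)
  then show "connected (open_cell X)" using assms by (cases X) simp_all
  show "open_cell X \<subseteq> cell X" by (cases X) (auto simp: mem_box less_imp_le)
qed

lemma cell_in_borel:
  fixes X :: "'a::euclidean_space spatial"
  shows "admissible X \<Longrightarrow> cell X \<in> sets borel"
proof (cases X)
  case Torus
  have "cell (Torus :: 'a spatial) = (\<Inter>b\<in>Basis. {x. 0 \<le> x \<bullet> b} \<inter> {x. x \<bullet> b < 1})" by auto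
  also have "\<dots> \<in> sets borel"
  proof (rule sets.finite_INT)
    show "{x::'a. 0 \<le> x \<bullet> b} \<inter> {x. x \<bullet> b < 1} \<in> sets borel" for b
      by (intro sets.Int borel_closed borel_open closed_Collect_le open_Collect_less continuous_intros)
  qed simp_all
  finally show ?thesis using Torus by simp
qed simp

lemma null_cell_minus_open_cell:
  fixes X :: "'a::euclidean_space spatial"
  shows "admissible X \<Longrightarrow> cell X - open_cell X \<in> null_sets lebesgue"
proof (cases X)
  case Torus
  have "negligible (cbox 0 One - box 0 (One::'a))" by (rule negligible_frontier_interval)
  moreover have "cell (Torus :: 'a spatial) - open_cell Torus \<subseteq> cbox 0 One - box 0 One"
    by (auto simp: mem_box less_imp_le)
  ultimately show ?thesis
    using Torus negligible_subset by (simp add: negligible_iff_null_sets[symmetric])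
qed simp

lemma measure_eq_open_cell:
  assumes X: "admissible X" and A: "A \<subseteq> cell X" "A \<inter> open_cell X \<in> sets borel"
  shows "measure lebesgue A = measure lborel (A \<inter> open_cell X)"
proof -
  have "A - open_cell X \<in> null_sets lebesgue"
    by (rule null_sets_completion_subset[OF _ null_cell_minus_open_cell[OF X]]) (use A(1) in auto)
  then have "measure lebesgue ((A \<inter> open_cell X) \<union> (A - open_cell X)) = measure lebesgue (A \<inter> open_cell X)"
    using A(2) by (intro measure_Un_null_set) auto
  moreover have "(A \<inter> open_cell X) \<union> (A - open_cell X) = A" by auto
  ultimately show ?thesis using A(2) by simp
qed

lemma nn_integral_open_cell_le:
  assumes X: "admissible X"
  shows "(\<integral>\<^sup>+x\<in>open_cell X. F x \<partial>lborel) \<le> (\<integral>\<^sup>+x\<in>cell X. F x \<partial>lebesgue)"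
  unfolding nn_integral_completion
  by (rule nn_integral_mono) (use open_cell(4)[OF X] in \<open>auto simp: indicator_def\<close>)

abbreviation cell_measure :: "'a::euclidean_space spatial \<Rightarrow> 'a measure" where
  "cell_measure X \<equiv> restrict_space lebesgue (cell X)"

lemma finite_cell_measure:
  assumes X: "admissible X"
  shows "finite_measure (cell_measure X)"
proof (rule finite_measureI)
  have "bounded (cell X)"
    by (rule bounded_subset[OF compact_imp_bounded]) (rule representatives[OF X])+
  then have "emeasure lborel (cell X) < \<infinity>" by (rule emeasure_bounded_finite)
  then show "emeasure (cell_measure X) (space (cell_measure X)) \<noteq> \<infinity>"
    using cell_in_borel[OF X] by (simp add: emeasure_restrict_space space_restrict_space)
qed

lemma space_cell_measure [simp]: "space (cell_measure X) = cell X"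
  by (simp add: space_restrict_space)

lemma cell_integral_eq:
  fixes F :: "'a::euclidean_space \<Rightarrow> real"
  assumes X: "admissible X"
  shows "(LINT x:cell X|lebesgue. F x) = (LINT x|cell_measure X. F x)"
  unfolding set_lebesgue_integral_def
  by (rule integral_restrict_space[symmetric]) (use cell_in_borel[OF X] in auto)

lemma cell_nn_integral_eq:
  assumes X: "admissible X"
  shows "(\<integral>\<^sup>+x\<in>cell X. F x \<partial>lebesgue) = (\<integral>\<^sup>+x. F x \<partial>cell_measure X)"
  by (rule nn_integral_restrict_space[symmetric]) (use cell_in_borel[OF X] in auto)

lemma borel_measurable_cell:
  fixes F :: "'a::euclidean_space \<Rightarrow> 'b::{second_countable_topology, real_normed_vector}"
  assumes X: "admissible X" and F: "continuous_on (bar X) F"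
  shows "F \<in> borel_measurable (cell_measure X)"
proof -
  have "cell X \<subseteq> bar X" using representatives[OF X] by simp
  then have "continuous_on (cell X) F" by (rule continuous_on_subset[OF F])
  then have "(\<lambda>x. indicator (cell X) x *\<^sub>R F x) \<in> borel_measurable borel"
    by (intro borel_measurable_continuous_on_indicator cell_in_borel X)
  then have "(\<lambda>x. indicator (cell X) x *\<^sub>R F x) \<in> borel_measurable lebesgue"
    by (simp add: measurable_completion)
  then show ?thesis
    by (subst borel_measurable_restrict_space_iff) (use cell_in_borel[OF X] in auto)
qed

lemma bounded_on_cell:
  fixes F :: "'a::euclidean_space \<Rightarrow> real"
  assumes X: "admissible X" and F: "continuous_on (bar X) F"
  shows "\<exists>B. \<forall>x\<in>cell X. \<bar>F x\<bar> \<le> B"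
proof -
  have "compact (F ` representatives X)"
    using representatives[OF X] continuous_on_subset[OF F] by (intro compact_continuous_image) auto
  then have "bounded (F ` representatives X)" by (rule compact_imp_bounded)
  then obtain B where "\<forall>y\<in>F ` representatives X. norm y \<le> B"
    by (auto simp: bounded_iff)
  then show ?thesis using representatives(3)[OF X] by (intro exI[of _ B]) auto
qed

lemma integrable_cell:
  fixes F :: "'a::euclidean_space \<Rightarrow> real"
  assumes X: "admissible X" and F: "continuous_on (bar X) F"
  shows "integrable (cell_measure X) F"
proof -
  interpret finite_measure "cell_measure X" by (rule finite_cell_measure[OF X])
  obtain B where "\<forall>x\<in>cell X. \<bar>F x\<bar> \<le> B" using bounded_on_cell[OF X F] by blast
  then show ?thesis
    by (intro integrable_const_bound[of _ B] AE_I2 borel_measurable_cell[OF X F]) auto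
qed

lemma Ck_bar_0: "Ck_bar 0 X g \<longleftrightarrow> continuous_on (bar X) g \<and> descends X g"
  by (simp add: Ck_bar_def)

lemma Ck_upto_1:
  "Ck_upto 1 S D g \<longleftrightarrow> continuous_on D g \<and> (\<exists>G. (\<forall>x\<in>S. GDERIV g x :> G x) \<and> continuous_on D G)"
  unfolding One_nat_def Ck_upto.simps by (subst continuous_on_componentwise[of D]) (rule refl)

lemma Ck_bar_1:
  "Ck_bar 1 X g \<longleftrightarrow> continuous_on (bar X) g \<and>
     (\<exists>G. (\<forall>x\<in>pts X. GDERIV g x :> G x) \<and> continuous_on (bar X) G) \<and> descends X g"
  unfolding Ck_bar_def Ck_upto_1 by blast

lemma uniformly_integrable_cell:
  assumes X: "admissible X" and ui: "uniformly_integrable X U"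
    and e: "0 < e"
  shows "\<exists>d>0. \<forall>u\<in>U. \<forall>A\<in>sets (cell_measure X).
        measure (cell_measure X) A \<le> d \<longrightarrow> (LINT x|cell_measure X. u x * indicator A x) \<le> e"
proof -
  let ?\<mu> = "cell_measure X"
  interpret finite_measure ?\<mu> by (rule finite_cell_measure[OF X])
  let ?S = "\<lambda>d. SUP (u, A) \<in> {(u, A). u \<in> U \<and> A \<in> sets lebesgue \<and> A \<subseteq> cell X \<and>
                            emeasure lebesgue A \<le> ennreal d}. \<integral>\<^sup>+x\<in>A. ennreal \<bar>u x\<bar> \<partial>lebesgue"
  have "(?S \<longlongrightarrow> 0) (at_right 0)" using ui unfolding uniformly_integrable_def by blast
  then have "\<forall>\<^sub>F d in at_right 0. ?S d < ennreal e" by (rule order_tendstoD) (use e in auto)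
  then obtain d0 where d0: "0 < d0" "\<And>d. 0 < d \<Longrightarrow> d < d0 \<Longrightarrow> ?S d < ennreal e"
    unfolding eventually_at_right_field by blast
  define d where "d = d0 / 2"
  have d: "0 < d" "?S d < ennreal e" using d0 by (auto simp: d_def)
  have "(LINT x|?\<mu>. u x * indicator A x) \<le> e" if u: "u \<in> U" and A: "A \<in> sets ?\<mu>" "measure ?\<mu> A \<le> d" for u A
  proof (rule integral_real_bounded)
    have cell: "cell X \<in> sets lebesgue" using cell_in_borel[OF X] by auto
    have A': "A \<in> sets lebesgue" "A \<subseteq> cell X" using A(1) cell by (auto simp: sets_restrict_space_iff)
    have "emeasure lebesgue A = emeasure ?\<mu> A" using A' cell by (subst emeasure_restrict_space) auto
    also have "\<dots> \<le> ennreal d" using A(2) by (simp add: emeasure_eq_measure ennreal_leI)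
    finally have mem: "(u, A) \<in> {(u, A). u \<in> U \<and> A \<in> sets lebesgue \<and> A \<subseteq> cell X \<and>
                            emeasure lebesgue A \<le> ennreal d}" using u A' by simp
    have "(\<integral>\<^sup>+x. ennreal (u x * indicator A x) \<partial>?\<mu>) = (\<integral>\<^sup>+x\<in>cell X. ennreal (u x * indicator A x) \<partial>lebesgue)"
      by (rule cell_nn_integral_eq[OF X, symmetric])
    also have "\<dots> \<le> (\<integral>\<^sup>+x\<in>A. ennreal \<bar>u x\<bar> \<partial>lebesgue)"
      by (intro nn_integral_mono) (auto simp: indicator_def ennreal_leI)
    also have "\<dots> \<le> ?S d" by (rule SUP_upper2[OF mem]) simp
    finally show "(\<integral>\<^sup>+x. ennreal (u x * indicator A x) \<partial>?\<mu>) \<le> ennreal e" using d(2) by simp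
  qed (use e in simp)
  then show ?thesis using d(1) by blast
qed

section \<open>The nonlinearity\<close>

locale reaction =
  fixes X :: "'a::euclidean_space spatial"
    and E f :: "'a \<Rightarrow> real \<Rightarrow> real"
    and m :: "'a \<Rightarrow> real"
  assumes X: "admissible X"
    and E_cont: "continuous_on (bar X \<times> {0..}) (\<lambda>(x, s). E x s)"
    and f_C1: "Ck_upto 1 (pts X \<times> {0<..}) (bar X \<times> {0<..}) (\<lambda>(x, s). f x s)"
    and f_desc: "\<And>s. 0 < s \<Longrightarrow> descends X (\<lambda>x. f x s)"
    and m_cont: "Ck_bar 0 X m"
    and m_mass: "(LINT x:cell X|lebesgue. m x) = 1"
    and E_nonneg: "\<And>x s. x \<in> bar X \<Longrightarrow> 0 \<le> s \<Longrightarrow> 0 \<le> E x s"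
    and m_pos: "\<And>x. x \<in> bar X \<Longrightarrow> 0 < m x"
    and E_m: "\<And>x. x \<in> pts X \<Longrightarrow> E x (m x) = 0"
    and E_deriv: "\<And>x s. x \<in> pts X \<Longrightarrow> 0 < s \<Longrightarrow> (E x has_real_derivative - f x s) (at s)"
    and f_deriv: "\<And>x s. x \<in> bar X \<Longrightarrow> 0 < s \<Longrightarrow> \<exists>l<0. (f x has_real_derivative l) (at s)"
begin

lemma bar_eq: "bar X = closure (pts X)"
  by (cases X) auto

text \<open>
  The gradient of \<open>(x, s) \<mapsto> f x s\<close>, extended continuously up to the boundary in \<open>x\<close>.
\<close>

definition Df :: "'a \<times> real \<Rightarrow> 'a \<times> real" where
  "Df = (SOME G. (\<forall>p\<in>pts X \<times> {0<..}. GDERIV (\<lambda>(x, s). f x s) p :> G p) \<and> continuous_on (bar X \<times> {0<..}) G)"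

lemma Df: "p \<in> pts X \<times> {0<..} \<Longrightarrow> GDERIV (\<lambda>(x, s). f x s) p :> Df p"
  and Df_cont: "continuous_on (bar X \<times> {0<..}) Df"
proof -
  have "\<exists>G. (\<forall>p\<in>pts X \<times> {0<..}. GDERIV (\<lambda>(x, s). f x s) p :> G p) \<and> continuous_on (bar X \<times> {0<..}) G"
    using f_C1 unfolding Ck_upto_1 by blast
  from someI_ex[OF this]
  show "p \<in> pts X \<times> {0<..} \<Longrightarrow> GDERIV (\<lambda>(x, s). f x s) p :> Df p" "continuous_on (bar X \<times> {0<..}) Df"
    unfolding Df_def by blast+
qed

lemma f_cont: "continuous_on (bar X \<times> {0<..}) (\<lambda>(x, s). f x s)"
  using f_C1 unfolding Ck_upto_1 by blast

lemma f_partial_pts: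
  assumes x: "x \<in> pts X" and s: "0 < s"
  shows "(f x has_real_derivative snd (Df (x, s))) (at s)"
proof -
  have "((\<lambda>(x, s). f x s) has_derivative (\<lambda>h. h \<bullet> Df (x, s))) (at (x, s))"
    using Df[of "(x, s)"] x s by (simp add: gderiv_def)
  moreover have "((\<lambda>t. (x, t)) has_derivative (\<lambda>t. (0, t))) (at s)"
    by (auto intro!: derivative_eq_intros)
  ultimately have "((\<lambda>t. (\<lambda>(x, s). f x s) (x, t)) has_derivative (\<lambda>t. (0, t) \<bullet> Df (x, s))) (at s)"
    by (rule has_derivative_compose[rotated])
  then show ?thesis
    by (simp add: has_field_derivative_def inner_prod_def mult_commute_abs)
qed

text \<open>
  At a boundary point \<open>Df\<close> is only a limit of gradients. The mean value bound for \<open>f y\<close> at nearby interior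
  points \<open>y\<close> is uniform in \<open>y\<close> and passes to the limit, which identifies the limit of the partial derivatives
  with the derivative of \<open>f x\<close>. This is what makes the sign of the derivative usable in compactness
  arguments on the closed set.
\<close>

lemma f_partial:
  assumes x: "x \<in> bar X" and s: "0 < s"
  shows "(f x has_real_derivative snd (Df (x, s))) (at s)"
proof -
  define L where "L = snd (Df (x, s))"
  have "\<exists>d>0. \<forall>r. norm (r - s) < d \<longrightarrow> norm (f x r - f x s - L * (r - s)) \<le> e * norm (r - s)" if e: "e > 0" for e
  proof -
    have "continuous_on (bar X \<times> {0<..}) (\<lambda>p. snd (Df p))"
      by (intro continuous_intros Df_cont)
    then obtain d0 where d0: "d0 > 0"
      "\<And>y r. y \<in> bar X \<Longrightarrow> r > 0 \<Longrightarrow> dist (y, r) (x, s) < d0 \<Longrightarrow> dist (snd (Df (y, r))) L < e"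
      using x s e unfolding continuous_on_iff L_def by force
    define d where "d = min (d0 / 2) s"
    have d: "d > 0" using d0 s by (simp add: d_def)
    have "norm (f x r - f x s - L * (r - s)) \<le> e * norm (r - s)" if r: "norm (r - s) < d" for r
    proof -
      have r0: "r > 0" using r by (auto simp: d_def abs_if split: if_splits)
      have near: "norm (f y r - f y s - L * (r - s)) \<le> e * norm (r - s)"
        if y: "y \<in> pts X" "dist y x < d0 / 2" for y
      proof -
        have "norm ((f y r - L * r) - (f y s - L * s)) \<le> e * norm (r - s)"
        proof (rule field_differentiable_bound[of "ball s d" "\<lambda>t. f y t - L * t" "\<lambda>t. snd (Df (y, t)) - L"])
          fix t assume t: "t \<in> ball s d"
          then have t0: "t > 0" by (auto simp: d_def dist_real_def)
          show "((\<lambda>t. f y t - L * t) has_field_derivative snd (Df (y, t)) - L) (at t within ball s d)"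
            by (rule has_field_derivative_at_within)
              (auto intro!: derivative_eq_intros f_partial_pts[OF y(1) t0])
          have "dist (y, t) (x, s) \<le> dist y x + dist t s"
            unfolding dist_Pair_Pair by (rule sqrt_sum_squares_le_sum) auto
          also have "\<dots> < d0" using y t by (simp add: d_def dist_commute)
          finally show "norm (snd (Df (y, t)) - L) \<le> e"
            using d0(2)[of y t] y(1) pts_subset_bar[of X] t0 by (auto simp: dist_real_def)
        qed (use r d in \<open>auto simp: dist_real_def abs_minus_commute\<close>)
        then show ?thesis by (simp add: algebra_simps)
      qed
      obtain y where y: "\<And>n. y n \<in> pts X" "y \<longlonglongrightarrow> x"
        using x unfolding bar_eq closure_sequential by blast
      have lim: "(\<lambda>n. f (y n) t) \<longlonglongrightarrow> f x t" if "t > 0" for t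
      proof -
        have "continuous_on (bar X) (\<lambda>z. (\<lambda>(x, s). f x s) (z, t))"
          by (rule continuous_on_compose2[OF f_cont]) (use that in \<open>auto intro!: continuous_intros\<close>)
        then have "continuous_on (bar X) (\<lambda>z. f z t)" by simp
        then show ?thesis
          using x y pts_subset_bar[of X] unfolding continuous_on_sequentially comp_def by blast
      qed
      have "(\<lambda>n. norm (f (y n) r - f (y n) s - L * (r - s))) \<longlonglongrightarrow> norm (f x r - f x s - L * (r - s))"
        by (intro tendsto_intros lim s r0)
      moreover have "\<forall>\<^sub>F n in sequentially. norm (f (y n) r - f (y n) s - L * (r - s)) \<le> e * norm (r - s)"
        using tendstoD[OF y(2), of "d0 / 2"] d0(1) near y(1) by (auto elim!: eventually_mono)
      ultimately show ?thesis by (rule tendsto_upperbound) simp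
    qed
    then show ?thesis using d by blast
  qed
  then show ?thesis
    unfolding has_field_derivative_def has_derivative_at_alt L_def by (auto intro: bounded_linear_mult_right)
qed

lemma f_partial_neg:
  assumes "x \<in> bar X" "0 < s"
  shows "snd (Df (x, s)) < 0"
  using f_deriv[OF assms] f_partial[OF assms] DERIV_unique by blast

lemma f_representative:
  assumes "x \<in> bar X"
  shows "\<exists>y\<in>representatives X. m x = m y \<and> (\<forall>s>0. f x s = f y s)"
proof -
  obtain y where "y \<in> representatives X" "\<And>g :: 'a \<Rightarrow> real. descends X g \<Longrightarrow> g x = g y"
    using ex_representative[OF assms, where ?'b = real] by blast
  then show ?thesis using f_desc m_cont unfolding Ck_bar_0 by (intro bexI[of _ y]) auto
qed

lemma f_slope_bounds:
  assumes a: "0 < a"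
  shows "\<exists>l>0. \<exists>\<Lambda>\<ge>l. \<forall>x\<in>bar X. \<forall>s t. a \<le> s \<and> s \<le> t \<and> t \<le> b \<longrightarrow>
     l * (t - s) \<le> f x s - f x t \<and> f x s - f x t \<le> \<Lambda> * (t - s)"
proof (cases "a \<le> b")
  case False
  then show ?thesis by (intro exI[of _ 1] conjI) auto
next
  case True
  let ?K = "representatives X \<times> {a..b}"
  note Q = representatives[OF X]
  have K: "compact ?K" "?K \<noteq> {}" using Q True by (auto intro: compact_Times)
  have cont: "continuous_on ?K (\<lambda>p. - snd (Df p))"
    by (intro continuous_intros continuous_on_subset[OF Df_cont]) (use Q a in auto)
  obtain p where p: "p \<in> ?K" "\<And>q. q \<in> ?K \<Longrightarrow> - snd (Df p) \<le> - snd (Df q)"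
    using continuous_attains_inf[OF K cont] by blast
  obtain p' where p': "p' \<in> ?K" "\<And>q. q \<in> ?K \<Longrightarrow> - snd (Df q) \<le> - snd (Df p')"
    using continuous_attains_sup[OF K cont] by blast
  have "0 < - snd (Df p)" using f_partial_neg[of "fst p" "snd p"] p(1) Q a by auto
  moreover have "- snd (Df p) \<le> - snd (Df p')" using p(2) p'(1) by blast
  moreover have "- snd (Df p) * (t - s) \<le> f x s - f x t \<and> f x s - f x t \<le> - snd (Df p') * (t - s)"
    if x: "x \<in> bar X" and st: "a \<le> s" "s \<le> t" "t \<le> b" for x s t
  proof (cases "s = t")
    case False
    then have lt: "s < t" using st by simp
    obtain y where y: "y \<in> representatives X" "\<And>s. s > 0 \<Longrightarrow> f x s = f y s"
      using f_representative[OF x] by blast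
    have "\<exists>z>s. z < t \<and> f y t - f y s = (t - s) * snd (Df (y, z))"
      by (rule MVT2[OF lt]) (use y(1) Q st a in \<open>auto intro!: f_partial\<close>)
    then obtain z where z: "s < z" "z < t" "f y t - f y s = (t - s) * snd (Df (y, z))" by blast
    have "(y, z) \<in> ?K" using y z st by auto
    from p(2)[OF this] p'(2)[OF this]
    have "- snd (Df p) * (t - s) \<le> - snd (Df (y, z)) * (t - s)" "- snd (Df (y, z)) * (t - s) \<le> - snd (Df p') * (t - s)"
      using lt by (auto intro!: mult_right_mono simp del: mult_minus_left)
    moreover have "f x s - f x t = - snd (Df (y, z)) * (t - s)"
      using z(3) y(2)[of s] y(2)[of t] st a by (simp add: algebra_simps)
    ultimately show ?thesis by simp
  qed simp
  ultimately show ?thesis by blast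
qed

lemma f_strict_anti:
  assumes "x \<in> bar X" "0 < s" "s < t"
  shows "f x t < f x s"
proof -
  obtain l where "l > 0" "l * (t - s) \<le> f x s - f x t"
    using f_slope_bounds[OF assms(2), of t] assms by fastforce
  moreover from this have "0 < l * (t - s)" using assms by simp
  ultimately show ?thesis by simp
qed

lemma f_anti: "x \<in> bar X \<Longrightarrow> 0 < s \<Longrightarrow> s \<le> t \<Longrightarrow> f x t \<le> f x s"
  using f_strict_anti[of x s t] by (cases "s = t") auto

lemma pts_in_bar: "x \<in> pts X \<Longrightarrow> x \<in> bar X"
  using pts_subset_bar by blast

lemma f_at_m:
  assumes x: "x \<in> pts X"
  shows "f x (m x) = 0"
proof -
  have mx: "0 < m x" using m_pos pts_in_bar x by blast
  have "- f x (m x) = 0"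
  proof (rule DERIV_local_min[OF E_deriv[OF x mx] mx])
    show "\<forall>y. \<bar>m x - y\<bar> < m x \<longrightarrow> E x (m x) \<le> E x y"
      using E_m[OF x] E_nonneg[OF pts_in_bar[OF x]] by auto
  qed
  then show ?thesis by simp
qed

lemma m_bounds: "\<exists>m0>0. \<exists>M0\<ge>m0. \<forall>x\<in>bar X. m0 \<le> m x \<and> m x \<le> M0"
proof -
  note Q = representatives[OF X]
  have cont: "continuous_on (representatives X) m"
    using m_cont Q(2) continuous_on_subset unfolding Ck_bar_0 by blast
  obtain y where y: "y \<in> representatives X" "\<And>z. z \<in> representatives X \<Longrightarrow> m y \<le> m z"
    using continuous_attains_inf[OF Q(1) Q(4) cont] by blast
  obtain y' where y': "y' \<in> representatives X" "\<And>z. z \<in> representatives X \<Longrightarrow> m z \<le> m y'"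
    using continuous_attains_sup[OF Q(1) Q(4) cont] by blast
  have "m y \<le> m x \<and> m x \<le> m y'" if "x \<in> bar X" for x
    using f_representative[OF that] y(2) y'(2) by force
  moreover have "0 < m y" using y(1) Q(2) m_pos by blast
  ultimately show ?thesis using y(2)[OF y'(1)] by blast
qed

lemma E_bounded: "\<exists>K\<ge>0. \<forall>x\<in>cell X. \<forall>s. 0 \<le> s \<and> s \<le> b \<longrightarrow> E x s \<le> K"
proof -
  note Q = representatives[OF X]
  have "compact ((\<lambda>(x, s). E x s) ` (representatives X \<times> {0..b}))"
    by (intro compact_continuous_image continuous_on_subset[OF E_cont] compact_Times) (use Q in auto)
  then have "bounded ((\<lambda>(x, s). E x s) ` (representatives X \<times> {0..b}))" by (rule compact_imp_bounded)
  then obtain K where K: "\<forall>y\<in>(\<lambda>(x, s). E x s) ` (representatives X \<times> {0..b}). norm y \<le> K"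
    by (auto simp: bounded_iff)
  have "E x s \<le> \<bar>K\<bar>" if "x \<in> cell X" "0 \<le> s" "s \<le> b" for x s
  proof -
    have "norm ((\<lambda>(x, s). E x s) (x, s)) \<le> K" using that Q(3) by (intro K[rule_format] imageI) auto
    then show ?thesis by simp
  qed
  then show ?thesis by (intro exI[of _ "\<bar>K\<bar>"]) auto
qed

lemma E_le_f:
  assumes x: "x \<in> pts X" and s: "0 < s"
  shows "E x s \<le> \<bar>m x - s\<bar> * \<bar>f x s\<bar>"
proof -
  note b = pts_in_bar[OF x]
  have mx: "0 < m x" using m_pos b by blast
  consider "s = m x" | "s < m x" | "m x < s" by linarith
  then show ?thesis
  proof cases
    case 1
    then show ?thesis using E_m[OF x] by simp
  next
    case 2
    have "\<exists>z>s. z < m x \<and> E x (m x) - E x s = (m x - s) * (- f x z)"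
      by (rule MVT2[OF 2]) (use s x in \<open>auto intro!: E_deriv\<close>)
    then obtain z where z: "s < z" "z < m x" "E x s = (m x - s) * f x z" using E_m[OF x] by auto
    have "f x z \<le> \<bar>f x s\<bar>" using f_anti[OF b s, of z] z by simp
    then have "(m x - s) * f x z \<le> (m x - s) * \<bar>f x s\<bar>" using 2 by (intro mult_left_mono) auto
    then show ?thesis using z(3) 2 by simp
  next
    case 3
    have "\<exists>z>m x. z < s \<and> E x s - E x (m x) = (s - m x) * (- f x z)"
      by (rule MVT2[OF 3]) (use mx x in \<open>auto intro!: E_deriv\<close>)
    then obtain z where z: "m x < z" "z < s" "E x s = (s - m x) * (- f x z)" using E_m[OF x] by auto
    have "- f x z \<le> \<bar>f x s\<bar>" using f_anti[OF b _ less_imp_le[OF z(2)]] z mx by simp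
    then have "(s - m x) * (- f x z) \<le> (s - m x) * \<bar>f x s\<bar>" using 3 by (intro mult_left_mono) auto
    then show ?thesis using z(3) 3 by simp
  qed
qed

text \<open>
  Replacing \<open>u\<close> by \<open>max u s'\<close> avoids the values of \<open>f x\<close> at \<open>0\<close>. It matters only where \<open>u < s'\<close>, and
  there \<open>\<psi> \<circ> f x\<close> is already constant. The product formula for \<open>G\<close> is continuous
  up to the boundary, and it vanishes together with \<open>\<psi>'\<close> on \<open>{u \<le> s0}\<close>, so it is the gradient on both sides of
  that level.
\<close>

lemma truncated_composition:
  assumes u: "Ck_bar 1 X u"
    and psi: "\<And>t. (\<psi> has_real_derivative \<psi>' t) (at t)" "continuous_on UNIV \<psi>'" "\<And>t. \<bar>\<psi>' t\<bar> \<le> L"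
    and flat: "\<And>t. A \<le> t \<Longrightarrow> \<psi> t = \<psi> A \<and> \<psi>' t = 0"
    and s: "0 < s'" "s' < s0"
    and big: "\<And>x s. x \<in> pts X \<Longrightarrow> 0 < s \<Longrightarrow> s \<le> s0 \<Longrightarrow> A \<le> f x s"
  defines "g \<equiv> \<lambda>x. \<psi> (f x (max (u x) s'))"
  shows "Ck_bar 1 X g"
    and "\<exists>G. (\<forall>x\<in>pts X. GDERIV g x :> G x) \<and> continuous_on (bar X) G \<and>
          (\<forall>x\<in>pts X. (u x \<le> s0 \<longrightarrow> G x = 0) \<and> norm (G x) \<le> L * norm (grad (\<lambda>y. f y (u y)) x))"
proof -
  obtain Du where u_cont: "continuous_on (bar X) u" and Du: "\<And>x. x \<in> pts X \<Longrightarrow> GDERIV u x :> Du x"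
    and Du_cont: "continuous_on (bar X) Du" and u_desc: "descends X u"
    using u unfolding Ck_bar_1 by blast
  have psi_cont: "continuous_on UNIV \<psi>"
    using psi(1) by (meson DERIV_isCont continuous_at_imp_continuous_on)
  define v where "v x = max (u x) s'" for x
  have v: "v x > 0" for x using s by (simp add: v_def less_max_iff_disj)
  have v_cont: "continuous_on (bar X) v" unfolding v_def by (intro continuous_intros u_cont)
  have pair: "continuous_on (bar X) (\<lambda>x. (x, v x))" by (intro continuous_intros v_cont)
  have "continuous_on (bar X) (\<lambda>x. (\<lambda>(x, s). f x s) (x, v x))"
    by (rule continuous_on_compose2[OF f_cont pair]) (use v in auto)
  then have fv: "continuous_on (bar X) (\<lambda>x. f x (v x))" by simp
  have Dfv: "continuous_on (bar X) (\<lambda>x. Df (x, v x))"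
    by (rule continuous_on_compose2[OF Df_cont pair]) (use v in auto)
  have g_cont: "continuous_on (bar X) g"
    unfolding g_def v_def[symmetric] by (rule continuous_on_compose2[OF psi_cont fv]) auto
  have g_desc: "descends X g"
  proof (cases X)
    case Torus
    then show ?thesis using u_desc f_desc v unfolding g_def v_def by simp
  qed simp
  define G where "G x = \<psi>' (f x (v x)) *\<^sub>R (fst (Df (x, v x)) + snd (Df (x, v x)) *\<^sub>R Du x)" for x
  have G_cont: "continuous_on (bar X) G"
    unfolding G_def
    by (intro continuous_intros continuous_on_compose2[OF psi(2) fv] Dfv Du_cont) auto
  have near: "\<exists>N. open N \<and> x \<in> N \<and> N \<subseteq> pts X \<and> (\<forall>y\<in>N. u y \<in> T)" if x: "x \<in> pts X" "u x \<in> T" "open T" for x T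
  proof -
    have "continuous_on (pts X) u" by (rule continuous_on_subset[OF u_cont pts_subset_bar])
    then have "open (u -` T \<inter> pts X)" using open_pts[OF X] \<open>open T\<close> continuous_on_open_vimage by blast
    then show ?thesis using x by (intro exI[of _ "u -` T \<inter> pts X"]) auto
  qed
  have flat_G: "G x = 0" if "x \<in> pts X" "u x \<le> s0" for x
    using flat[of "f x (v x)"] big[OF that(1) v, of x] that(2) s by (simp add: G_def v_def)
  have f_u: "GDERIV (\<lambda>y. f y (u y)) x :> fst (Df (x, u x)) + snd (Df (x, u x)) *\<^sub>R Du x"
    if x: "x \<in> pts X" "0 < u x" for x
  proof -
    have "((\<lambda>(x, s). f x s) has_derivative (\<lambda>h. h \<bullet> Df (x, u x))) (at (x, u x))"
      using Df[of "(x, u x)"] x by (simp add: gderiv_def)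
    moreover have "((\<lambda>y. (y, u y)) has_derivative (\<lambda>h. (h, h \<bullet> Du x))) (at x)"
      using Du[OF x(1)] unfolding gderiv_def by (intro has_derivative_Pair has_derivative_ident)
    ultimately have "((\<lambda>y. (\<lambda>(x, s). f x s) (y, u y)) has_derivative (\<lambda>h. (h, h \<bullet> Du x) \<bullet> Df (x, u x))) (at x)"
      by (rule has_derivative_compose[rotated])
    moreover have "(h, h \<bullet> Du x) \<bullet> Df (x, u x) = h \<bullet> (fst (Df (x, u x)) + snd (Df (x, u x)) *\<^sub>R Du x)" for h
      by (simp add: inner_prod_def inner_add_right)
    ultimately show ?thesis by (simp add: gderiv_def)
  qed
  have der: "GDERIV g x :> G x" if x: "x \<in> pts X" for x
  proof (cases "u x < s0")
    case True
    obtain N where N: "open N" "x \<in> N" "N \<subseteq> pts X" "\<forall>y\<in>N. u y \<in> {..<s0}"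
      using near[OF x, of "{..<s0}"] True by auto
    have "g y = \<psi> A" if "y \<in> N" for y
    proof -
      have "A \<le> f y (v y)" using N that s by (intro big v) (auto simp: v_def less_imp_le)
      then show ?thesis using flat[of "f y (v y)"] unfolding g_def v_def by blast
    qed
    moreover have "((\<lambda>_. \<psi> A) has_derivative (\<lambda>h. h \<bullet> G x)) (at x)"
      using flat_G[OF x] True by simp
    ultimately show ?thesis unfolding gderiv_def
      by (metis (no_types, lifting) N(1,2) has_derivative_transform_within_open)
  next
    case False
    then have ux: "u x \<in> {s'<..}" using s by simp
    obtain N where N: "open N" "x \<in> N" "N \<subseteq> pts X" "\<forall>y\<in>N. u y \<in> {s'<..}"
      using near[OF x ux] by auto
    have eq: "(\<lambda>y. \<psi> (f y (u y))) y = g y" if "y \<in> N" for y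
      using bspec[OF N(4) that] by (auto simp: g_def max_def)
    have vx: "v x = u x" using ux by (simp add: v_def)
    have "((\<lambda>y. \<psi> (f y (u y))) has_derivative (\<lambda>h. h \<bullet> G x)) (at x)"
    proof -
      have "((\<lambda>y. f y (u y)) has_derivative (\<lambda>h. h \<bullet> (fst (Df (x, u x)) + snd (Df (x, u x)) *\<^sub>R Du x))) (at x)"
        using f_u[OF x] ux s by (simp add: gderiv_def)
      moreover have "(\<psi> has_derivative (\<lambda>h. \<psi>' (f x (u x)) * h)) (at (f x (u x)))"
        using psi(1) by (simp add: has_field_derivative_def)
      ultimately have "((\<lambda>y. \<psi> (f y (u y))) has_derivative
         (\<lambda>h. \<psi>' (f x (u x)) * (h \<bullet> (fst (Df (x, u x)) + snd (Df (x, u x)) *\<^sub>R Du x)))) (at x)"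
        by (rule has_derivative_compose)
      then show ?thesis by (simp add: G_def vx)
    qed
    then show ?thesis unfolding gderiv_def
      by (rule has_derivative_transform_within_open[OF _ N(1,2)]) (use eq in auto)
  qed
  show "Ck_bar 1 X g" unfolding Ck_bar_1 using g_cont der G_cont g_desc by blast
  have bound: "norm (G x) \<le> L * norm (grad (\<lambda>y. f y (u y)) x)" if x: "x \<in> pts X" for x
  proof (cases "u x \<le> s0")
    case True
    have "0 \<le> L" using psi(3)[of 0] by simp
    then show ?thesis using flat_G[OF x True] by simp
  next
    case False
    then have vx: "v x = u x" and "0 < u x" using s by (auto simp: v_def)
    then show ?thesis
      using grad_eq[OF f_u[OF x]] psi(3)[of "f x (u x)"] by (simp add: G_def vx mult_right_mono)
  qed
  show "\<exists>G. (\<forall>x\<in>pts X. GDERIV g x :> G x) \<and> continuous_on (bar X) G \<and>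
          (\<forall>x\<in>pts X. (u x \<le> s0 \<longrightarrow> G x = 0) \<and> norm (G x) \<le> L * norm (grad (\<lambda>y. f y (u y)) x))"
    using der G_cont flat_G bound by blast
qed

end

section \<open>Constants and pointwise estimates\<close>

text \<open>
  \<open>R\<close> stands for a level above which the densities in question carry little mass; the slopes \<open>l\<close> and \<open>\<Lambda>\<close> of \<open>f x\<close>
  are those on the range between \<open>m0 / 4\<close> and \<open>R\<close>.
\<close>

locale reaction_constants = reaction X E f m
  for X :: "'a::euclidean_space spatial" and E f :: "'a \<Rightarrow> real \<Rightarrow> real" and m :: "'a \<Rightarrow> real" +
  fixes m0 M0 R l \<Lambda> :: real
  assumes m0: "0 < m0" and m0_le_m: "\<And>x. x \<in> bar X \<Longrightarrow> m0 \<le> m x"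
    and m_le_M0: "\<And>x. x \<in> bar X \<Longrightarrow> m x \<le> M0" and R: "M0 + 1 \<le> R"
    and l: "0 < l" "l \<le> \<Lambda>"
    and slope: "\<And>x s t. x \<in> bar X \<Longrightarrow> m0 / 4 \<le> s \<Longrightarrow> s \<le> t \<Longrightarrow> t \<le> R \<Longrightarrow>
        l * (t - s) \<le> f x s - f x t \<and> f x s - f x t \<le> \<Lambda> * (t - s)"
begin

definition s0 :: real where "s0 = m0 / 2"
definition s1 :: real where "s1 = m0 / 4"

text \<open>
  Half of the lower bound for \<open>f x s\<close> that the slope \<open>l\<close> gives at \<open>s = s0\<close>, where \<open>m x - s \<ge> m0 / 2\<close>.
\<close>

definition \<kappa> :: real where "\<kappa> = l * m0 / 4"

abbreviation "\<mu> \<equiv> cell_measure X"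

definition dissipation :: "('a \<Rightarrow> real) \<Rightarrow> ennreal" where
  "dissipation u = (\<integral>\<^sup>+x. ennreal (u x * (norm (grad (\<lambda>y. f y (u y)) x))\<^sup>2) \<partial>\<mu>)"

lemma pos: "0 < s0" "0 < s1" "s1 < s0" "0 < \<kappa>" "0 < \<Lambda>"
  using m0 l by (auto simp: s0_def s1_def \<kappa>_def)

lemma M0: "m0 \<le> M0"
  using m0_le_m m_le_M0 representatives[OF X] by (metis (no_types, lifting) ex_in_conv order_trans subsetD)

lemma cell_pts: "x \<in> cell X \<Longrightarrow> x \<in> pts X" and cell_bar: "x \<in> cell X \<Longrightarrow> x \<in> bar X"
  using cell_subset_pts pts_subset_bar by blast+

lemma f_below_m:
  assumes x: "x \<in> pts X" and s: "s1 \<le> s" "s \<le> m x"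
  shows "l * (m x - s) \<le> f x s" "f x s \<le> \<Lambda> * (m x - s)"
  using slope[of x s "m x"] s m_le_M0[of x] pts_in_bar[OF x] R f_at_m[OF x] by (auto simp: s1_def)

lemma f_above_m:
  assumes x: "x \<in> pts X" and s: "m x \<le> s" "s \<le> R"
  shows "l * (s - m x) \<le> - f x s" "- f x s \<le> \<Lambda> * (s - m x)"
  using slope[of x "m x" s] s m0_le_m[of x] pts_in_bar[OF x] m0 f_at_m[OF x] by auto

lemma f_small_density:
  assumes x: "x \<in> pts X" and s: "0 < s" "s \<le> s0"
  shows "2 * \<kappa> \<le> f x s"
proof -
  have mx: "m0 \<le> m x" using m0_le_m pts_in_bar x by blast
  have "2 * \<kappa> = l * (m0 - s0)" by (simp add: \<kappa>_def s0_def algebra_simps)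
  also have "\<dots> \<le> l * (m x - s0)" using mx l by (intro mult_left_mono) auto
  also have "\<dots> \<le> f x s0" using mx m0 by (intro f_below_m x) (auto simp: s0_def s1_def)
  also have "\<dots> \<le> f x s" by (rule f_anti[OF pts_in_bar[OF x] s])
  finally show ?thesis .
qed

lemma f_large_density:
  assumes x: "x \<in> pts X" and s: "R \<le> s"
  shows "f x s \<le> - l"
proof -
  note b = pts_in_bar[OF x]
  have mx: "m x \<le> M0" "0 < m x" using m_le_M0 m_pos b by auto
  have "l * 1 \<le> l * (R - m x)" using mx R l by (intro mult_left_mono) auto
  also have "\<dots> \<le> - f x R" using mx R by (intro f_above_m x) auto
  also have "\<dots> \<le> - f x s" using f_anti[OF b _ s] mx R by simp
  finally show ?thesis by simp
qed

text \<open>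
  \<open>B\<close> collects the three bounds for the quotient \<open>(m x - s) / \<phi> (f x s)\<close> relative to \<open>s\<close>: \<open>1 / l\<close> where \<open>f x s\<close> is
  below \<open>\<kappa>\<close> and \<open>s \<le> R\<close>, \<open>M0 / \<kappa>\<close> where it exceeds \<open>\<kappa>\<close>, and \<open>s / l\<close> where \<open>s > R\<close>. \<open>F\<close> is what the truncation costs
  in size, as \<open>f x s \<le> \<Lambda> * M0\<close> for \<open>s > s0\<close>.
\<close>

definition B :: real where "B = (1 / l + M0 / \<kappa>) / s0 + 1 / l"
definition F :: real where "F = 1 + \<Lambda> * M0 / \<kappa>"

lemma B: "0 < B" and F: "0 < F"
  using pos l M0 m0 unfolding B_def F_def by (auto intro!: add_pos_pos add_pos_nonneg divide_pos_pos)

text \<open>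
  The truncation \<open>\<phi>\<close> vanishes only with its argument, so \<open>\<phi> (f x s)\<close> and \<open>m x - s\<close> have the same sign and are
  comparable as long as \<open>s\<close> stays in a compact range. For large \<open>s\<close> the function \<open>f x\<close> may decrease at any rate,
  which leaves only the upper bound for the quotient.
\<close>

lemma truncated_slope:
  assumes phi: "\<And>t. t \<le> \<kappa> \<Longrightarrow> \<phi> t = t" "\<And>t. \<phi> t \<le> t" "\<And>t. \<kappa> \<le> t \<Longrightarrow> \<kappa> \<le> \<phi> t"
    and x: "x \<in> pts X" and s: "s0 < s"
  shows "\<exists>b\<ge>0. m x - s = b * \<phi> (f x s) \<and> b \<le> B * s \<and> (s \<le> R \<longrightarrow> 1 / \<Lambda> \<le> b)"
    and "\<bar>f x s\<bar> \<le> F * \<bar>\<phi> (f x s)\<bar>"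
proof -
  note b = pts_in_bar[OF x]
  have mx: "m0 \<le> m x" "m x \<le> M0" using m0_le_m m_le_M0 b by auto
  have s': "s1 \<le> s" "0 < s" using s pos by auto
  have Bs: "1 / l + M0 / \<kappa> \<le> B * s" "s / l \<le> B * s"
  proof -
    have "1 / l + M0 / \<kappa> \<le> (1 / l + M0 / \<kappa>) / s0 * s"
      using mult_left_mono[of s0 s "(1 / l + M0 / \<kappa>) / s0"] s pos l M0 m0 by simp
    moreover have "0 \<le> 1 / l * s" "0 \<le> (1 / l + M0 / \<kappa>) / s0 * s" using s' l pos M0 m0 by auto
    ultimately show "1 / l + M0 / \<kappa> \<le> B * s" "s / l \<le> B * s"
      by (auto simp: B_def distrib_right)
  qed
  have Mk: "0 \<le> M0 / \<kappa>" using M0 m0 pos by simp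
  consider "s = m x" | "s < m x" | "m x < s" by linarith
  then have "(\<exists>b\<ge>0. m x - s = b * \<phi> (f x s) \<and> b \<le> B * s \<and> (s \<le> R \<longrightarrow> 1 / \<Lambda> \<le> b)) \<and>
     \<bar>f x s\<bar> \<le> F * \<bar>\<phi> (f x s)\<bar>"
  proof cases
    case 1
    have "1 / \<Lambda> \<le> 1 / l" using l by (simp add: frac_le)
    then show ?thesis using 1 f_at_m[OF x] phi(1)[of 0] pos Bs(1) Mk by (intro conjI exI[of _ "1 / \<Lambda>"]) auto
  next
    case 2
    have f: "l * (m x - s) \<le> f x s" "f x s \<le> \<Lambda> * (m x - s)" using f_below_m[OF x s'(1)] 2 by auto
    have lpos: "0 < l * (m x - s)" using 2 l by simp
    let ?g = "\<phi> (f x s)"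
    have g: "0 < ?g" "(m x - s) \<le> (1 / l + M0 / \<kappa>) * ?g" "f x s \<le> F * ?g"
    proof -
      have "0 < ?g \<and> (m x - s) \<le> (1 / l + M0 / \<kappa>) * ?g \<and> f x s \<le> F * ?g"
      proof (cases "f x s \<le> \<kappa>")
        case True
        then have eq: "?g = f x s" by (rule phi(1))
        have "m x - s \<le> 1 / l * f x s" using f(1) l by (simp add: field_simps)
        moreover have "0 \<le> M0 / \<kappa> * f x s" "0 \<le> \<Lambda> * M0 / \<kappa> * f x s"
          using Mk f(1) lpos pos M0 m0 by auto
        ultimately show ?thesis unfolding eq using f(1) lpos by (auto simp: F_def distrib_right)
      next
        case False
        then have g: "\<kappa> \<le> ?g" using phi(3) by simp
        have "M0 \<le> M0 / \<kappa> * ?g" using g pos M0 m0 by (simp add: field_simps mult_left_mono)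
        moreover have "f x s \<le> \<Lambda> * M0" using f(2) mult_left_mono[of "m x - s" M0 \<Lambda>] mx s' pos by linarith
        moreover have "\<Lambda> * M0 \<le> \<Lambda> * M0 / \<kappa> * ?g" using g pos M0 m0 by (simp add: field_simps mult_left_mono)
        moreover have "0 \<le> 1 / l * ?g" using g pos l by simp
        ultimately show ?thesis using g pos mx s' by (auto simp: F_def distrib_right)
      qed
      then show "0 < ?g" "(m x - s) \<le> (1 / l + M0 / \<kappa>) * ?g" "f x s \<le> F * ?g" by auto
    qed
    have "(m x - s) / ?g \<le> 1 / l + M0 / \<kappa>" using g by (simp add: pos_divide_le_eq)
    moreover have "1 / \<Lambda> \<le> (m x - s) / ?g"
      using f(2) phi(2)[of "f x s"] g(1) pos by (simp add: field_simps)
    ultimately show ?thesis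
      using g 2 lpos f(1) Bs(1) by (intro conjI exI[of _ "(m x - s) / ?g"]) auto
  next
    case 3
    have neg: "f x s < 0" using f_strict_anti[OF b _ 3] f_at_m[OF x] mx m0 by simp
    then have eq: "\<phi> (f x s) = f x s" using phi(1) pos by simp
    have F1: "1 \<le> F" using Mk pos M0 m0 by (simp add: F_def)
    let ?b = "(s - m x) / (- f x s)"
    have "?b \<le> B * s"
    proof (cases "s \<le> R")
      case True
      then have "?b \<le> 1 / l" using f_above_m[OF x less_imp_le[OF 3] True] neg l by (simp add: field_simps)
      then show ?thesis using Bs(1) Mk by linarith
    next
      case False
      have "?b \<le> s / l" using f_large_density[OF x, of s] False l mx m0 3 by (intro frac_le) auto
      then show ?thesis using Bs(2) by linarith
    qed
    moreover have "1 / \<Lambda> \<le> ?b" if "s \<le> R"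
      using f_above_m[OF x less_imp_le[OF 3] that] neg pos by (simp add: field_simps)
    moreover have "\<bar>f x s\<bar> \<le> F * \<bar>f x s\<bar>" using F1 by (simp add: mult_le_cancel_right1)
    ultimately show ?thesis unfolding eq using neg 3 by (intro conjI exI[of _ ?b]) (auto simp: field_simps)
  qed
  then show "\<exists>b\<ge>0. m x - s = b * \<phi> (f x s) \<and> b \<le> B * s \<and> (s \<le> R \<longrightarrow> 1 / \<Lambda> \<le> b)"
    and "\<bar>f x s\<bar> \<le> F * \<bar>\<phi> (f x s)\<bar>" by auto
qed

lemma E_le_truncated:
  assumes phi: "\<And>t. t \<le> \<kappa> \<Longrightarrow> \<phi> t = t" "\<And>t. \<phi> t \<le> t" "\<And>t. \<kappa> \<le> t \<Longrightarrow> \<kappa> \<le> \<phi> t"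
    and x: "x \<in> pts X" and s: "s0 < s"
  shows "E x s \<le> B * F * (s * (\<phi> (f x s))\<^sup>2)"
proof -
  have s': "0 < s" using s pos by simp
  obtain b where b: "b \<ge> 0" "m x - s = b * \<phi> (f x s)" "b \<le> B * s"
    using truncated_slope(1)[OF phi x s] by blast
  have "E x s \<le> \<bar>m x - s\<bar> * \<bar>f x s\<bar>" by (rule E_le_f[OF x s'])
  also have "\<dots> \<le> (B * s * \<bar>\<phi> (f x s)\<bar>) * (F * \<bar>\<phi> (f x s)\<bar>)"
    using b B s' by (intro mult_mono truncated_slope(2)[OF phi x s]) (auto simp: abs_mult mult_right_mono)
  also have "\<dots> = B * F * (s * (\<phi> (f x s))\<^sup>2)" by (simp add: power2_eq_square)
  finally show ?thesis .
qed

lemma mass_m: "integrable \<mu> m" "(LINT x|\<mu>. m x) = 1"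
  using m_cont m_mass integrable_cell[OF X] cell_integral_eq[OF X] unfolding Ck_bar_0 by auto

definition T :: real where "T = measure \<mu> (space \<mu>)"

lemma T: "0 < T" "m0 * T \<le> 1"
proof -
  interpret finite_measure \<mu> by (rule finite_cell_measure[OF X])
  have "1 \<le> (LINT x|\<mu>. M0)" unfolding mass_m(2)[symmetric]
    by (rule integral_mono) (use mass_m m_le_M0 cell_bar in auto)
  then have "1 \<le> T * M0" by (simp add: T_def)
  then show "0 < T" using M0 m0 by (smt (verit) mult_nonpos_nonneg)
  have "(LINT x|\<mu>. m0) \<le> 1" unfolding mass_m(2)[symmetric]
    by (rule integral_mono) (use mass_m m0_le_m cell_bar in auto)
  then show "m0 * T \<le> 1" by (simp add: T_def mult.commute)
qed

text \<open>
  The gradient of the truncated composition vanishes where \<open>u \<le> s0\<close>; elsewhere \<open>1 \<le> u / s0\<close>. This is how the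
  weighted dissipation controls an unweighted gradient energy.
\<close>

lemma grad_energy_le:
  assumes u: "Ck_bar 1 X u" and u0: "\<And>x. x \<in> bar X \<Longrightarrow> 0 \<le> u x"
    and psi: "\<And>t. (\<psi> has_real_derivative \<psi>' t) (at t)" "continuous_on UNIV \<psi>'" "\<And>t. \<bar>\<psi>' t\<bar> \<le> L"
    and flat: "\<And>t. A \<le> t \<Longrightarrow> \<psi> t = \<psi> A \<and> \<psi>' t = 0" and A: "A \<le> 2 * \<kappa>"
    and L: "0 < L"
  defines "g \<equiv> \<lambda>x. \<psi> (f x (max (u x) s1))"
  shows "Ck_bar 1 X g"
    and "\<exists>G. (\<forall>x\<in>pts X. GDERIV g x :> G x) \<and> continuous_on (bar X) G \<and>
        (\<integral>\<^sup>+x. ennreal (u x * (norm (G x))\<^sup>2) \<partial>\<mu>) \<le> ennreal (L\<^sup>2) * dissipation u \<and>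
        (\<integral>\<^sup>+x. ennreal ((norm (G x))\<^sup>2) \<partial>\<mu>) \<le> ennreal (L\<^sup>2 / s0) * dissipation u"
proof -
  have big: "A \<le> f x s" if "x \<in> pts X" "0 < s" "s \<le> s0" for x s
    using f_small_density[OF that] A by simp
  note tc = truncated_composition[OF u psi flat pos(2,3) big]
  show "Ck_bar 1 X g" unfolding g_def by (rule tc(1))
  obtain G where G: "\<forall>x\<in>pts X. GDERIV g x :> G x" "continuous_on (bar X) G"
    "\<And>x. x \<in> pts X \<Longrightarrow> u x \<le> s0 \<Longrightarrow> G x = 0"
    "\<And>x. x \<in> pts X \<Longrightarrow> norm (G x) \<le> L * norm (grad (\<lambda>y. f y (u y)) x)"
    using tc(2) unfolding g_def by blast
  let ?N = "\<lambda>x. (norm (grad (\<lambda>y. f y (u y)) x))\<^sup>2"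
  have G2: "(norm (G x))\<^sup>2 \<le> L\<^sup>2 * ?N x" if "x \<in> cell X" for x
    using power_mono[OF G(4)[OF cell_pts[OF that]], of 2] by (simp add: power_mult_distrib)
  have u_cont: "continuous_on (bar X) u" using u unfolding Ck_bar_1 by blast
  have [measurable]: "u \<in> borel_measurable \<mu>" "G \<in> borel_measurable \<mu>"
    by (rule borel_measurable_cell[OF X u_cont], rule borel_measurable_cell[OF X G(2)])
  have "ennreal (u x * (norm (G x))\<^sup>2) \<le> ennreal (L\<^sup>2) * ennreal (u x * ?N x)" if x: "x \<in> cell X" for x
    using mult_left_mono[OF G2[OF x] u0[OF cell_bar[OF x]]]
    by (simp add: ennreal_mult'[symmetric] ennreal_leI mult_ac)
  then have 1: "(\<integral>\<^sup>+x. ennreal (u x * (norm (G x))\<^sup>2) \<partial>\<mu>) \<le> ennreal (L\<^sup>2) * dissipation u"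
    unfolding dissipation_def using L by (intro nn_integral_le_cmult) auto
  have "ennreal ((norm (G x))\<^sup>2) \<le> ennreal (L\<^sup>2 / s0) * ennreal (u x * ?N x)" if x: "x \<in> cell X" for x
  proof (cases "u x \<le> s0")
    case False
    have "(norm (G x))\<^sup>2 \<le> 1 * (L\<^sup>2 * ?N x)" using G2[OF x] by simp
    also have "\<dots> \<le> (u x / s0) * (L\<^sup>2 * ?N x)" using False pos by (intro mult_right_mono) auto
    finally show ?thesis using pos by (simp add: ennreal_mult'[symmetric] ennreal_leI mult_ac)
  qed (use G(3) cell_pts x in simp)
  then have 2: "(\<integral>\<^sup>+x. ennreal ((norm (G x))\<^sup>2) \<partial>\<mu>) \<le> ennreal (L\<^sup>2 / s0) * dissipation u"
    unfolding dissipation_def using L pos by (intro nn_integral_le_cmult) auto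
  show "\<exists>G. (\<forall>x\<in>pts X. GDERIV g x :> G x) \<and> continuous_on (bar X) G \<and>
        (\<integral>\<^sup>+x. ennreal (u x * (norm (G x))\<^sup>2) \<partial>\<mu>) \<le> ennreal (L\<^sup>2) * dissipation u \<and>
        (\<integral>\<^sup>+x. ennreal ((norm (G x))\<^sup>2) \<partial>\<mu>) \<le> ennreal (L\<^sup>2 / s0) * dissipation u"
    using G(1,2) 1 2 by blast
qed

end

section \<open>Families of densities\<close>

locale reaction_family = reaction_constants X E f m m0 M0 R l \<Lambda>
  for X :: "'a::euclidean_space spatial" and E f :: "'a \<Rightarrow> real \<Rightarrow> real" and m :: "'a \<Rightarrow> real"
    and m0 M0 R l \<Lambda> :: real +
  fixes U :: "('a \<Rightarrow> real) set" and c :: real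
  assumes U_C1: "\<And>u. u \<in> U \<Longrightarrow> Ck_bar 1 X u"
    and U_nonneg: "\<And>u x. u \<in> U \<Longrightarrow> x \<in> bar X \<Longrightarrow> 0 \<le> u x"
    and U_mass: "\<And>u. u \<in> U \<Longrightarrow> (LINT x|cell_measure X. u x) = 1"
    and U_ui: "\<And>e. 0 < e \<Longrightarrow> \<exists>d>0. \<forall>u\<in>U. \<forall>A\<in>sets (cell_measure X).
        measure (cell_measure X) A \<le> d \<longrightarrow> (LINT x|cell_measure X. u x * indicator A x) \<le> e"
    and U_tail: "\<And>u. u \<in> U \<Longrightarrow> (LINT x|cell_measure X. u x * indicator {x\<in>cell X. R < u x} x) \<le> 1 / 4"
    and U_Poincare: "\<And>u. u \<in> U \<Longrightarrow> weighted_Poincare X c u"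
begin

lemma U_cont: "u \<in> U \<Longrightarrow> continuous_on (bar X) u"
  using U_C1 unfolding Ck_bar_1 by blast

lemma U_int: "u \<in> U \<Longrightarrow> integrable \<mu> u" and U_meas: "u \<in> U \<Longrightarrow> u \<in> borel_measurable \<mu>"
  using U_cont integrable_cell[OF X] by auto

lemma U_times_int: "u \<in> U \<Longrightarrow> continuous_on (bar X) k \<Longrightarrow> integrable \<mu> (\<lambda>x. u x * k x)"
  by (intro integrable_cell[OF X] continuous_on_mult) (auto intro: U_cont)

lemma integrable_indicator_cell: "A \<in> sets \<mu> \<Longrightarrow> integrable \<mu> (indicator A :: 'a \<Rightarrow> real)"
proof -
  interpret finite_measure \<mu> by (rule finite_cell_measure[OF X])
  show "A \<in> sets \<mu> \<Longrightarrow> integrable \<mu> (indicator A :: 'a \<Rightarrow> real)"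
    by (rule integrable_real_indicator) (use emeasure_finite[of A] in \<open>auto simp: less_top[symmetric]\<close>)
qed

lemma Int_cell: "A \<in> sets \<mu> \<Longrightarrow> A \<inter> cell X = A"
  using sets.Int_space_eq2[of A \<mu>] by simp

lemma integrable_times_indicator_cell:
  fixes v :: "'a \<Rightarrow> real"
  assumes "integrable \<mu> v" "A \<in> sets \<mu>"
  shows "integrable \<mu> (\<lambda>x. v x * indicator A x)"
  by (rule integrable_mult_indicator[OF assms(2,1), THEN Bochner_Integration.integrable_cong[THEN iffD1, rotated -1]])
    (auto simp: indicator_def)

lemma Poincare_cell:
  assumes u: "u \<in> U" and g: "Ck_bar 1 X g" and G: "\<And>x. x \<in> pts X \<Longrightarrow> GDERIV g x :> G x"
  shows "(LINT x|\<mu>. u x * (g x - (LINT y|\<mu>. u y * g y))\<^sup>2) \<le> c * (LINT x|\<mu>. u x * (norm (G x))\<^sup>2)"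
proof -
  have "(LINT x|\<mu>. u x * (norm (grad g x))\<^sup>2) = (LINT x|\<mu>. u x * (norm (G x))\<^sup>2)"
    by (rule Bochner_Integration.integral_cong) (auto simp: grad_eq[OF G[OF cell_pts]])
  then show ?thesis
    using U_Poincare[OF u] g unfolding weighted_Poincare_def cell_integral_eq[OF X] by auto
qed

definition low_set :: "('a \<Rightarrow> real) \<Rightarrow> real" where
  "low_set u = measure \<mu> {x\<in>cell X. u x \<le> s0}"

text \<open>
  The values up to \<open>s0\<close> carry at most half of the mass, since \<open>s0\<close> is half of a lower bound for \<open>m\<close>, and
  the values above \<open>R\<close> at most a quarter.
\<close>

lemma middle_values:
  assumes u: "u \<in> U"
  shows "1 / (4 * R) \<le> measure \<mu> {x\<in>cell X. s0 < u x \<and> u x \<le> R}"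
proof -
  interpret finite_measure \<mu> by (rule finite_cell_measure[OF X])
  note [measurable] = U_meas[OF u]
  have R0: "0 < R" using R M0 m0 by simp
  let ?A = "{x\<in>cell X. s0 < u x \<and> u x \<le> R}" and ?H = "{x\<in>cell X. R < u x}"
  have "?A = {x\<in>space \<mu>. s0 < u x \<and> u x \<le> R}" "?H = {x\<in>space \<mu>. R < u x}" by auto
  moreover have "{x\<in>space \<mu>. s0 < u x \<and> u x \<le> R} \<in> sets \<mu>" "{x\<in>space \<mu>. R < u x} \<in> sets \<mu>" by measurable
  ultimately have A: "?A \<in> sets \<mu>" and H: "?H \<in> sets \<mu>" by auto
  have "1 = (LINT x|\<mu>. u x)" using U_mass[OF u] by simp
  also have "\<dots> \<le> (LINT x|\<mu>. s0 + R * indicator ?A x + u x * indicator ?H x)"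
  proof (rule integral_mono)
    show "integrable \<mu> (\<lambda>x. s0 + R * indicator ?A x + u x * indicator ?H x)"
      using integrable_indicator_cell[OF A] integrable_times_indicator_cell[OF U_int[OF u] H] by simp
    show "u x \<le> s0 + R * indicator ?A x + u x * indicator ?H x" if "x \<in> space \<mu>" for x
      using that pos R0 by (auto simp: indicator_def)
  qed (rule U_int[OF u])
  also have "\<dots> = s0 * T + R * measure \<mu> ?A + (LINT x|\<mu>. u x * indicator ?H x)"
    using integrable_indicator_cell[OF A] integrable_times_indicator_cell[OF U_int[OF u] H] A
    by (simp add: T_def mult.commute Int_cell)
  also have "\<dots> \<le> 1 / 2 + R * measure \<mu> ?A + 1 / 4"
    using U_tail[OF u] T by (simp add: s0_def)
  finally show ?thesis using R0 by (simp add: field_simps)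
qed

lemma integral_le_of_nn_integral_le:
  assumes "0 \<le> J" "(\<integral>\<^sup>+x. ennreal (k x) \<partial>\<mu>) \<le> ennreal a * D" "D \<le> ennreal J" "0 \<le> a"
  shows "(LINT x|\<mu>. k x) \<le> a * J"
proof (rule integral_real_bounded)
  have "(\<integral>\<^sup>+x. ennreal (k x) \<partial>\<mu>) \<le> ennreal a * ennreal J"
    using assms(2) mult_left_mono[OF assms(3)] order_trans by (metis zero_le)
  then show "(\<integral>\<^sup>+x. ennreal (k x) \<partial>\<mu>) \<le> ennreal (a * J)" using assms by (simp add: ennreal_mult)
qed (use assms in simp)

lemma energy_le_dissipation_plus_low_set:
  "\<exists>C\<ge>0. \<forall>u\<in>U. \<forall>J\<ge>0. dissipation u \<le> ennreal J \<longrightarrow>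
     (\<integral>\<^sup>+x. ennreal (E x (u x)) \<partial>\<mu>) \<le> ennreal (C * (J + low_set u))"
proof -
  obtain \<phi> \<phi>' where phi: "\<And>t. (\<phi> has_real_derivative \<phi>' t) (at t)" "continuous_on UNIV \<phi>'" "\<And>t. \<bar>\<phi>' t\<bar> \<le> 1"
    "\<And>t. t \<le> \<kappa> \<Longrightarrow> \<phi> t = t" "\<And>t. \<phi> t \<le> t" "\<And>t. \<kappa> \<le> t \<Longrightarrow> \<kappa> \<le> \<phi> t"
    "\<And>t. 2 * \<kappa> \<le> t \<Longrightarrow> \<phi> t = \<phi> (2 * \<kappa>) \<and> \<phi>' t = 0"
    using ex_C1_truncation[OF pos(4)] by blast
  obtain K' where K': "0 \<le> K'" "\<And>x s. x \<in> cell X \<Longrightarrow> 0 \<le> s \<Longrightarrow> s \<le> s0 \<Longrightarrow> E x s \<le> K'"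
    using E_bounded by blast
  define q where "q = 1 / (4 * R)"
  have q: "0 < q" using R M0 m0 by (simp add: q_def)
  define a where "a = B * F * (1 + 2 * B\<^sup>2 / (1 / \<Lambda> * q)\<^sup>2)"
  define b where "b = K' + B * F * (2 * M0\<^sup>2 * T / (1 / \<Lambda> * q)\<^sup>2)"
  have a: "0 \<le> a" unfolding a_def using B F by (intro mult_nonneg_nonneg add_nonneg_nonneg divide_nonneg_nonneg) auto
  have b: "0 \<le> b" unfolding b_def using B F K' T by (intro mult_nonneg_nonneg add_nonneg_nonneg divide_nonneg_nonneg) auto
  have "(\<integral>\<^sup>+x. ennreal (E x (u x)) \<partial>\<mu>) \<le> ennreal ((a * \<bar>c\<bar> + b) * (J + low_set u))"
    if u: "u \<in> U" and J: "0 \<le> J" and diss: "dissipation u \<le> ennreal J" for u J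
  proof -
    define g where "g x = \<phi> (f x (max (u x) s1))" for x
    have g1: "Ck_bar 1 X g" unfolding g_def
      by (rule grad_energy_le(1)[OF U_C1[OF u] U_nonneg[OF u] phi(1,2,3,7)]) auto
    obtain G where G: "\<And>x. x \<in> pts X \<Longrightarrow> GDERIV g x :> G x" "continuous_on (bar X) G"
      "(\<integral>\<^sup>+x. ennreal (u x * (norm (G x))\<^sup>2) \<partial>\<mu>) \<le> ennreal (1\<^sup>2) * dissipation u"
      using grad_energy_le(2)[OF U_C1[OF u] U_nonneg[OF u] phi(1,2,3,7)] unfolding g_def by auto
    have g_cont: "continuous_on (bar X) g" using g1 unfolding Ck_bar_1 by blast
    have g_eq: "g x = \<phi> (f x (u x))" if "s0 < u x" for x using that pos by (simp add: g_def max_def)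
    have ig: "integrable \<mu> (\<lambda>x. u x * g x)" and ig2: "integrable \<mu> (\<lambda>x. u x * (g x)\<^sup>2)"
      by (intro U_times_int u continuous_intros g_cont)+
    define V where "V = (LINT x|\<mu>. u x * (g x - (LINT y|\<mu>. u y * g y))\<^sup>2)"
    have "(LINT x|\<mu>. u x * (norm (G x))\<^sup>2) \<le> J"
      using integral_le_of_nn_integral_le[OF J G(3) diss] by simp
    moreover have "0 \<le> (LINT x|\<mu>. u x * (norm (G x))\<^sup>2)"
      by (intro integral_nonneg_AE AE_I2) (use U_nonneg[OF u] cell_bar in auto)
    ultimately have "c * (LINT x|\<mu>. u x * (norm (G x))\<^sup>2) \<le> \<bar>c\<bar> * J"
      by (intro mult_mono) auto
    then have V: "V \<le> \<bar>c\<bar> * J" unfolding V_def using Poincare_cell[OF u g1 G(1)] by simp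
    have "(\<integral>\<^sup>+x. ennreal (E x (u x)) \<partial>\<mu>) \<le> ennreal (a * V + b * measure \<mu> {x\<in>space \<mu>. u x \<le> s0})"
      unfolding a_def b_def V_def
    proof (rule energy_le_variance_plus_low_set[where R = R and m = m])
      show "finite_measure \<mu>" by (rule finite_cell_measure[OF X])
      fix x assume x: "x \<in> space \<mu>"
      then have xp: "x \<in> pts X" and xb: "x \<in> bar X" using cell_pts cell_bar by auto
      show "0 \<le> u x" by (rule U_nonneg[OF u xb])
      { assume s: "s0 < u x"
        show "\<exists>b\<ge>0. m x - u x = b * g x \<and> b \<le> B * u x \<and> (u x \<le> R \<longrightarrow> 1 / \<Lambda> \<le> b)"
          unfolding g_eq[OF s] by (rule truncated_slope(1)[OF phi(4,5,6) xp s])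
        show "E x (u x) \<le> B * F * (u x * (g x)\<^sup>2)"
          unfolding g_eq[OF s] by (rule E_le_truncated[OF phi(4,5,6) xp s]) }
      { assume s: "u x \<le> s0"
        show "\<bar>m x - u x\<bar> \<le> M0"
          using s m0_le_m[OF xb] m_le_M0[OF xb] U_nonneg[OF u xb] m0 by (auto simp: s0_def)
        show "E x (u x) \<le> K'" using K'(2) x U_nonneg[OF u xb] s by auto }
    next
      show "q \<le> measure \<mu> {x \<in> space \<mu>. s0 < u x \<and> u x \<le> R}"
        using middle_values[OF u] by (simp add: q_def)
    qed (use U_int[OF u] mass_m ig ig2 U_mass[OF u] B F pos q K' M0 m0 in \<open>auto simp: T_def\<close>)
    also have "\<dots> \<le> ennreal (a * (\<bar>c\<bar> * J) + b * low_set u)"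
      unfolding low_set_def using V a b by (intro ennreal_leI add_mono mult_left_mono) auto
    also have "\<dots> \<le> ennreal ((a * \<bar>c\<bar> + b) * (J + low_set u))"
    proof (rule ennreal_leI)
      have "0 \<le> b * J" "0 \<le> a * \<bar>c\<bar> * low_set u" using a b J by (auto simp: low_set_def)
      then show "a * (\<bar>c\<bar> * J) + b * low_set u \<le> (a * \<bar>c\<bar> + b) * (J + low_set u)"
        by (simp add: algebra_simps)
    qed
    finally show ?thesis .
  qed
  then show ?thesis using a b by (intro exI[of _ "a * \<bar>c\<bar> + b"]) auto
qed

text \<open>
  As in the truncated compositions, \<open>max (u x) s1\<close> keeps the argument of \<open>f x\<close> positive.
\<close>

definition high_level :: "real \<Rightarrow> ('a \<Rightarrow> real) \<Rightarrow> 'a set" where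
  "high_level e u = {x\<in>cell X. e \<le> f x (max (u x) s1)}"

lemma f_truncated_cont:
  assumes u: "u \<in> U"
  shows "continuous_on (bar X) (\<lambda>x. f x (max (u x) s1))"
proof -
  have "continuous_on (bar X) (\<lambda>x. (\<lambda>(x, s). f x s) (x, max (u x) s1))"
  proof (rule continuous_on_compose2[OF f_cont])
    show "continuous_on (bar X) (\<lambda>x. (x, max (u x) s1))" by (intro continuous_intros U_cont[OF u])
  qed (use pos in \<open>auto simp: less_max_iff_disj\<close>)
  then show ?thesis by simp
qed

lemma high_level_sets: "u \<in> U \<Longrightarrow> high_level e u \<in> sets \<mu>"
proof -
  assume u: "u \<in> U"
  note [measurable] = borel_measurable_cell[OF X f_truncated_cont[OF u]]
  have "high_level e u = {x\<in>space \<mu>. e \<le> f x (max (u x) s1)}" by (simp add: high_level_def)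
  also have "\<dots> \<in> sets \<mu>" by measurable
  finally show ?thesis .
qed

text \<open>
  Where \<open>f\<close> exceeds \<open>e\<close>, the density \<open>u\<close> stays below \<open>m\<close> by at least \<open>e / \<Lambda>\<close>. If this happened on most of the
  domain, the missing mass would have to sit on a small set, against uniform integrability.
\<close>

lemma level_below_not_small:
  assumes e: "0 < e"
  shows "\<exists>\<eta>>0. \<forall>u\<in>U. \<eta> \<le> measure \<mu> {x\<in>cell X. f x (max (u x) s1) \<le> e}"
proof -
  interpret finite_measure \<mu> by (rule finite_cell_measure[OF X])
  define a where "a = e / \<Lambda>"
  have a: "0 < a" using e pos by (simp add: a_def)
  obtain d where d: "0 < d" "\<And>u A. u \<in> U \<Longrightarrow> A \<in> sets \<mu> \<Longrightarrow> measure \<mu> A \<le> d \<Longrightarrow>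
      (LINT x|\<mu>. u x * indicator A x) \<le> a * T / 4"
    using U_ui[of "a * T / 4"] a T by auto
  have "min (T / 2) d \<le> measure \<mu> {x\<in>cell X. f x (max (u x) s1) \<le> e}" if u: "u \<in> U" for u
  proof (rule ccontr)
    let ?B = "{x\<in>cell X. f x (max (u x) s1) \<le> e}"
    note [measurable] = borel_measurable_cell[OF X f_truncated_cont[OF u]]
    have "?B = {x\<in>space \<mu>. f x (max (u x) s1) \<le> e}" by simp
    also have "\<dots> \<in> sets \<mu>" by measurable
    finally have B: "?B \<in> sets \<mu>" .
    assume "\<not> ?thesis"
    then have small: "measure \<mu> ?B < T / 2" "measure \<mu> ?B \<le> d" by auto
    have "1 = (LINT x|\<mu>. u x)" using U_mass[OF u] by simp
    also have "\<dots> \<le> (LINT x|\<mu>. u x * indicator ?B x + (m x - a) + a * indicator ?B x)"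
    proof (rule integral_mono)
      show "integrable \<mu> (\<lambda>x. u x * indicator ?B x + (m x - a) + a * indicator ?B x)"
        using integrable_indicator_cell[OF B] integrable_times_indicator_cell[OF U_int[OF u] B] mass_m(1) by simp
      fix x assume x: "x \<in> space \<mu>"
      then have xp: "x \<in> pts X" and xb: "x \<in> bar X" using cell_pts cell_bar by auto
      show "u x \<le> u x * indicator ?B x + (m x - a) + a * indicator ?B x"
      proof (cases "x \<in> ?B")
        case True
        then show ?thesis using m_pos[OF xb] by simp
      next
        case False
        let ?v = "max (u x) s1"
        have fv: "e < f x ?v" using False x by simp
        have v: "0 < ?v" "s1 \<le> ?v" using pos by (auto simp: less_max_iff_disj)
        have "?v \<le> m x"
        proof (rule ccontr)
          assume "\<not> ?v \<le> m x"
          then have "f x ?v \<le> f x (m x)" by (intro f_anti xb m_pos) auto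
          then show False using fv e f_at_m[OF xp] by simp
        qed
        then have "e < \<Lambda> * (m x - ?v)" using f_below_m(2)[OF xp v(2)] fv by simp
        then have "a < m x - ?v" using pos by (simp add: a_def field_simps)
        then show ?thesis using False by simp
      qed
    qed (rule U_int[OF u])
    also have "\<dots> = (LINT x|\<mu>. u x * indicator ?B x) + (1 - a * T) + a * measure \<mu> ?B"
      using integrable_indicator_cell[OF B] integrable_times_indicator_cell[OF U_int[OF u] B] mass_m B
      by (simp add: T_def mult.commute Int_cell)
    also have "\<dots> < a * T / 4 + (1 - a * T) + a * (T / 2)"
      using d(2)[OF u B small(2)] small(1) a by (intro add_le_less_mono mult_strict_left_mono add_right_mono) auto
    finally show False using mult_pos_pos[OF a T(1)] by simp
  qed
  then show ?thesis using d(1) T by (intro exI[of _ "min (T / 2) d"]) auto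
qed

text \<open>
  The step function that rises from \<open>0\<close> to \<open>1\<close> as \<open>f\<close> runs from \<open>e\<close> to \<open>2 * e\<close> has small gradient energy, and its
  zero set is not small. So the set where it equals \<open>1\<close> is small.
\<close>

lemma small_dissipation_small_high_level:
  assumes e: "0 < e" "e \<le> \<kappa>" and eta: "0 < \<eta>"
  shows "\<exists>\<delta>>0. \<forall>u\<in>U. dissipation u \<le> ennreal \<delta> \<longrightarrow> measure \<mu> (high_level (2 * e) u) < \<eta>"
proof -
  let ?W = "open_cell X"
  note W = open_cell[OF X]
  have Wp: "?W \<subseteq> pts X" using W(4) cell_subset_pts by blast
  obtain \<theta> \<theta>' where th: "\<And>t. (\<theta> has_real_derivative \<theta>' t) (at t)" "continuous_on UNIV \<theta>'" "\<And>t. \<bar>\<theta>' t\<bar> \<le> 2 / e"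
    "\<And>t. t \<le> e \<Longrightarrow> \<theta> t = 0" "\<And>t. 2 * e \<le> t \<Longrightarrow> \<theta> t = 1 \<and> \<theta>' t = 0"
    using ex_C1_step[OF e(1)] by blast
  have flat: "\<theta> t = \<theta> (2 * e) \<and> \<theta>' t = 0" if "2 * e \<le> t" for t using th(5)[OF that] th(5)[of "2 * e"] by simp
  obtain \<eta>1 where eta1: "0 < \<eta>1" "\<And>u. u \<in> U \<Longrightarrow> \<eta>1 \<le> measure \<mu> {x\<in>cell X. f x (max (u x) s1) \<le> e}"
    using level_below_not_small[OF e(1)] by blast
  define L where "L = 2 / e"
  have L: "0 < L" using e by (simp add: L_def)
  obtain \<delta> where delta: "0 < \<delta>" "\<And>h G. C1_on ?W h G \<Longrightarrow> (\<integral>\<^sup>+x\<in>?W. ennreal ((norm (G x))\<^sup>2) \<partial>lborel) \<le> ennreal \<delta> \<Longrightarrow>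
     measure lborel {x\<in>?W. h x = 0} < min \<eta> \<eta>1 \<or> measure lborel {x\<in>?W. h x = 1} < min \<eta> \<eta>1"
    using small_energy_separates_no_large_sets[OF W(1,2,3), of "min \<eta> \<eta>1"] eta eta1(1) by auto
  define d where "d = \<delta> * s0 / L\<^sup>2"
  have d: "0 < d" using delta pos L by (simp add: d_def)
  have "measure \<mu> (high_level (2 * e) u) < \<eta>" if u: "u \<in> U" and diss: "dissipation u \<le> ennreal d" for u
  proof -
    interpret finite_measure \<mu> by (rule finite_cell_measure[OF X])
    define h where "h x = \<theta> (f x (max (u x) s1))" for x
    obtain G where G: "\<And>x. x \<in> pts X \<Longrightarrow> GDERIV h x :> G x" "continuous_on (bar X) G"
      "(\<integral>\<^sup>+x. ennreal ((norm (G x))\<^sup>2) \<partial>\<mu>) \<le> ennreal (L\<^sup>2 / s0) * dissipation u"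
      using grad_energy_le(2)[OF U_C1[OF u] U_nonneg[OF u] th(1,2,3) flat] e unfolding h_def L_def by auto
    have h1: "C1_on ?W h G"
      unfolding C1_on_def using G(1,2) Wp pts_subset_bar[of X] by (auto intro: continuous_on_subset)
    have "(\<integral>\<^sup>+x\<in>?W. ennreal ((norm (G x))\<^sup>2) \<partial>lborel) \<le> (\<integral>\<^sup>+x. ennreal ((norm (G x))\<^sup>2) \<partial>\<mu>)"
      using nn_integral_open_cell_le[OF X] unfolding cell_nn_integral_eq[OF X] .
    also have "\<dots> \<le> ennreal (L\<^sup>2 / s0) * ennreal d"
      using G(3) mult_left_mono[OF diss, of "ennreal (L\<^sup>2 / s0)"] order_trans by fastforce
    also have "\<dots> = ennreal \<delta>" using d L pos by (simp add: ennreal_mult'[symmetric] d_def)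
    finally have sep: "measure lborel {x\<in>?W. h x = 0} < min \<eta> \<eta>1 \<or> measure lborel {x\<in>?W. h x = 1} < min \<eta> \<eta>1"
      by (rule delta(2)[OF h1])
    have level: "measure \<mu> {x\<in>cell X. h x = b} = measure lborel {x\<in>?W. h x = b}"
      and level_sets: "{x\<in>cell X. h x = b} \<in> sets \<mu>" for b
    proof -
      have eq: "{x\<in>cell X. h x = b} \<inter> ?W = {x\<in>?W. h x = b}" using W(4) by auto
      have "{x\<in>?W. h x = b} \<in> sets borel"
        using W(1) C1_on_continuous[OF h1] by (intro level_set_in_borel) auto
      then show "measure \<mu> {x\<in>cell X. h x = b} = measure lborel {x\<in>?W. h x = b}"
        using measure_eq_open_cell[OF X, of "{x\<in>cell X. h x = b}"] cell_in_borel[OF X]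
        by (subst measure_restrict_space) (auto simp: eq)
      have "continuous_on UNIV \<theta>"
        using th(1) by (meson DERIV_isCont continuous_at_imp_continuous_on)
      then have "continuous_on (bar X) h"
        unfolding h_def by (rule continuous_on_compose2[OF _ f_truncated_cont[OF u]]) auto
      note [measurable] = borel_measurable_cell[OF X this]
      have "{x\<in>space \<mu>. h x = b} \<in> sets \<mu>" by measurable
      then show "{x\<in>cell X. h x = b} \<in> sets \<mu>" by simp
    qed
    have "\<eta>1 \<le> measure \<mu> {x\<in>cell X. f x (max (u x) s1) \<le> e}" by (rule eta1(2)[OF u])
    also have "\<dots> \<le> measure \<mu> {x\<in>cell X. h x = 0}"
      by (intro finite_measure_mono level_sets) (auto simp: h_def th(4))
    finally have "measure lborel {x\<in>?W. h x = 1} < \<eta>" using sep level[of 0] by auto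
    moreover have "measure \<mu> (high_level (2 * e) u) \<le> measure \<mu> {x\<in>cell X. h x = 1}"
      by (intro finite_measure_mono level_sets) (auto simp: h_def high_level_def th(5))
    ultimately show ?thesis using level[of 1] by simp
  qed
  then show ?thesis using d by blast
qed

lemma low_set_subset_high_level:
  assumes "e \<le> \<kappa>"
  shows "{x\<in>cell X. u x \<le> s0} \<subseteq> high_level (2 * e) u"
proof
  fix x assume x: "x \<in> {x\<in>cell X. u x \<le> s0}"
  then have "2 * \<kappa> \<le> f x (max (u x) s1)"
    using pos cell_pts by (intro f_small_density) (auto simp: less_max_iff_disj)
  then show "x \<in> high_level (2 * e) u" using x assms by (simp add: high_level_def)
qed

text \<open>
  By equality of masses \<open>\<bar>u - m\<bar>\<close> has twice the integral of the positive part of \<open>m - u\<close>. That part is at most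
  \<open>2 * e / l\<close> off the high level set and at most \<open>M0\<close> on it.
\<close>

lemma small_dissipation_L1_close:
  assumes eta: "0 < \<eta>"
  shows "\<exists>\<delta>>0. \<forall>u\<in>U. dissipation u \<le> ennreal \<delta> \<longrightarrow> (LINT x|\<mu>. \<bar>u x - m x\<bar>) < \<eta>"
proof -
  define e where "e = min \<kappa> (\<eta> * l / (16 * T))"
  have e: "0 < e" "e \<le> \<kappa>" and e': "e \<le> \<eta> * l / (16 * T)" using eta pos l T by (auto simp: e_def)
  have M: "0 < M0" using M0 m0 by simp
  obtain \<delta> where delta: "0 < \<delta>" "\<And>u. u \<in> U \<Longrightarrow> dissipation u \<le> ennreal \<delta> \<Longrightarrow>
      measure \<mu> (high_level (2 * e) u) < \<eta> / (4 * M0)"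
    using small_dissipation_small_high_level[OF e, of "\<eta> / (4 * M0)"] eta M by auto
  have "(LINT x|\<mu>. \<bar>u x - m x\<bar>) < \<eta>" if u: "u \<in> U" and diss: "dissipation u \<le> ennreal \<delta>" for u
  proof -
    let ?H = "high_level (2 * e) u"
    note H = high_level_sets[OF u, of "2 * e"]
    have "(LINT x|\<mu>. \<bar>u x - m x\<bar>) \<le> (LINT x|\<mu>. (u x - m x) + 4 * e / l + 2 * M0 * indicator ?H x)"
    proof (rule integral_mono)
      interpret finite_measure \<mu> by (rule finite_cell_measure[OF X])
      show "integrable \<mu> (\<lambda>x. \<bar>u x - m x\<bar>)" using U_int[OF u] mass_m(1) by auto
      show "integrable \<mu> (\<lambda>x. (u x - m x) + 4 * e / l + 2 * M0 * indicator ?H x)"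
        using U_int[OF u] mass_m(1) integrable_indicator_cell[OF H] by auto
      fix x assume x: "x \<in> space \<mu>"
      then have xp: "x \<in> pts X" and xb: "x \<in> bar X" using cell_pts cell_bar by auto
      have el: "0 \<le> e / l" using e l by simp
      have mx: "m x \<le> M0" and u0: "0 \<le> u x" using m_le_M0[OF xb] U_nonneg[OF u xb] by auto
      consider "m x \<le> u x" | "u x < m x" "x \<in> ?H" | "u x < m x" "x \<notin> ?H" by fastforce
      then show "\<bar>u x - m x\<bar> \<le> (u x - m x) + 4 * e / l + 2 * M0 * indicator ?H x"
      proof cases
        case 3
        then have us: "s0 < u x" using low_set_subset_high_level[OF e(2), of u] x by force
        then have v: "max (u x) s1 = u x" using pos by simp
        have "l * (m x - u x) \<le> f x (u x)" using 3 us pos by (intro f_below_m xp) auto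
        also have "\<dots> < 2 * e" using 3 x v by (auto simp: high_level_def)
        finally have "m x - u x \<le> 2 * e / l" using l by (simp add: field_simps)
        moreover have "4 * e / l = 2 * (2 * e / l)" by simp
        ultimately show ?thesis using 3 by simp
      qed (use el M mx u0 in \<open>auto simp: indicator_def\<close>)
    qed
    also have "\<dots> = 4 * e / l * T + 2 * M0 * measure \<mu> ?H"
    proof -
      interpret finite_measure \<mu> by (rule finite_cell_measure[OF X])
      show ?thesis using U_int[OF u] mass_m U_mass[OF u] integrable_indicator_cell[OF H] H
        by (simp add: T_def mult.commute Int_cell)
    qed
    also have "\<dots> < \<eta> / 2 + \<eta> / 2"
    proof (rule add_le_less_mono)
      have "e * (16 * T) \<le> \<eta> * l" using e' T by (simp add: field_simps)
      then have "4 * e * T \<le> \<eta> / 4 * l" by simp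
      then have "4 * e / l * T \<le> \<eta> / 4" using l by (simp add: field_simps)
      then show "4 * e / l * T \<le> \<eta> / 2" using eta by simp
      show "2 * M0 * measure \<mu> ?H < \<eta> / 2" using delta(2)[OF u diss] M by (simp add: field_simps)
    qed
    finally show ?thesis by simp
  qed
  then show ?thesis using delta(1) by blast
qed

lemma low_set_le_T: "u \<in> U \<Longrightarrow> low_set u \<le> T"
proof -
  interpret finite_measure \<mu> by (rule finite_cell_measure[OF X])
  show ?thesis unfolding low_set_def T_def by (rule bounded_measure)
qed

text \<open>
  The weight \<open>m\<close> inherits the Poincare inequality. For small dissipation the mean with respect to \<open>m\<close> of the
  step function at level \<open>\<kappa>\<close> is at most \<open>1 / 2\<close>, while the function equals \<open>1\<close> on \<open>{u \<le> s0}\<close>; so its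
  variance is at least \<open>m0 / 4\<close> times the measure of that set.
\<close>

lemma low_set_le_dissipation_if_close:
  assumes approx: "\<And>\<eta>. 0 < \<eta> \<Longrightarrow> \<exists>u\<in>U. (LINT x|\<mu>. \<bar>u x - m x\<bar>) < \<eta>"
  shows "\<exists>C\<ge>0. \<exists>\<delta>>0. \<forall>u\<in>U. \<forall>J. 0 \<le> J \<and> J \<le> \<delta> \<and> dissipation u \<le> ennreal J \<longrightarrow> low_set u \<le> C * J"
proof -
  have M: "0 < M0" using M0 m0 by simp
  obtain \<theta> \<theta>' where th: "\<And>t. (\<theta> has_real_derivative \<theta>' t) (at t)" "continuous_on UNIV \<theta>'" "\<And>t. \<bar>\<theta>' t\<bar> \<le> 2 / \<kappa>"
    "\<And>t. t \<le> \<kappa> \<Longrightarrow> \<theta> t = 0" "\<And>t. 2 * \<kappa> \<le> t \<Longrightarrow> \<theta> t = 1 \<and> \<theta>' t = 0" "\<And>t. 0 \<le> \<theta> t" "\<And>t. \<theta> t \<le> 1"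
    using ex_C1_step[OF pos(4)] by blast
  have flat: "\<theta> t = \<theta> (2 * \<kappa>) \<and> \<theta>' t = 0" if "2 * \<kappa> \<le> t" for t using th(5)[OF that] th(5)[of "2 * \<kappa>"] by simp
  define L where "L = 2 / \<kappa>"
  have L: "0 < L" using pos by (simp add: L_def)
  obtain \<delta> where delta: "0 < \<delta>" "\<And>u. u \<in> U \<Longrightarrow> dissipation u \<le> ennreal \<delta> \<Longrightarrow>
      measure \<mu> (high_level (2 * (\<kappa> / 2)) u) < 1 / (2 * M0)"
    using small_dissipation_small_high_level[of "\<kappa> / 2" "1 / (2 * M0)"] M pos by auto
  have "low_set u \<le> (4 / m0 * (\<bar>c\<bar> * (M0 * (L\<^sup>2 / s0)))) * J"
    if u: "u \<in> U" and J: "0 \<le> J" "J \<le> \<delta>" and diss: "dissipation u \<le> ennreal J" for u J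
  proof -
    interpret finite_measure \<mu> by (rule finite_cell_measure[OF X])
    define h where "h x = \<theta> (f x (max (u x) s1))" for x
    have h1: "Ck_bar 1 X h" unfolding h_def
      by (rule grad_energy_le(1)[OF U_C1[OF u] U_nonneg[OF u] th(1,2,3) flat]) (use pos in auto)
    have h_cont: "continuous_on (bar X) h" using h1 unfolding Ck_bar_1 by blast
    obtain G where G: "\<And>x. x \<in> pts X \<Longrightarrow> GDERIV h x :> G x" "continuous_on (bar X) G"
      "(\<integral>\<^sup>+x. ennreal ((norm (G x))\<^sup>2) \<partial>\<mu>) \<le> ennreal (L\<^sup>2 / s0) * dissipation u"
      using grad_energy_le(2)[OF U_C1[OF u] U_nonneg[OF u] th(1,2,3) flat] pos unfolding h_def L_def by auto
    have N_cont: "continuous_on (bar X) (\<lambda>x. (norm (G x))\<^sup>2)" by (intro continuous_intros G(2))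
    obtain b where b: "\<And>x. x \<in> cell X \<Longrightarrow> \<bar>(norm (G x))\<^sup>2\<bar> \<le> b"
      using bounded_on_cell[OF X N_cont] by blast
    define r where "r = (LINT y|\<mu>. m y * h y)"
    have h01: "0 \<le> h x" "h x \<le> 1" for x by (auto simp: h_def th)
    have m_cont': "continuous_on (bar X) m" using m_cont unfolding Ck_bar_0 by blast
    have Poincare_m: "(LINT x|\<mu>. m x * (h x - r)\<^sup>2) \<le> c * (LINT x|\<mu>. m x * (norm (G x))\<^sup>2)"
      unfolding r_def
    proof (rule weighted_Poincare_L1_limit[where U = U and B = 1 and B' = b])
      show "(LINT x|\<mu>. v x * (h x - (LINT y|\<mu>. v y * h y))\<^sup>2) \<le> c * (LINT x|\<mu>. v x * (norm (G x))\<^sup>2)" if "v \<in> U" for v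
        by (rule Poincare_cell[OF that h1 G(1)])
    qed (use U_int U_mass mass_m borel_measurable_cell[OF X h_cont] borel_measurable_cell[OF X N_cont] h01 b approx
        finite_cell_measure[OF X] in auto)
    let ?H = "high_level (2 * (\<kappa> / 2)) u"
    note H = high_level_sets[OF u, of "2 * (\<kappa> / 2)"]
    have "r \<le> (LINT x|\<mu>. M0 * indicator ?H x)"
      unfolding r_def
    proof (rule integral_mono)
      show "integrable \<mu> (\<lambda>x. m x * h x)" by (intro integrable_cell[OF X] continuous_intros m_cont' h_cont)
      show "integrable \<mu> (\<lambda>x. M0 * indicator ?H x)" using integrable_indicator_cell[OF H] by auto
      fix x assume x: "x \<in> space \<mu>"
      then have xb: "x \<in> bar X" using cell_bar by auto
      show "m x * h x \<le> M0 * indicator ?H x"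
      proof (cases "x \<in> ?H")
        case True
        then show ?thesis using mult_mono[OF m_le_M0[OF xb] h01(2)] M h01 by simp
      next
        case False
        then have "h x = 0" using x by (auto simp: h_def high_level_def intro!: th(4))
        then show ?thesis using False by simp
      qed
    qed
    also have "\<dots> = M0 * measure \<mu> ?H" using H by (simp add: Int_cell)
    also have "\<dots> \<le> 1 / 2"
    proof -
      have "dissipation u \<le> ennreal \<delta>" using diss J by (meson ennreal_leI order_trans)
      from delta(2)[OF u this] show ?thesis using M by (simp add: field_simps)
    qed
    finally have r: "r \<le> 1 / 2" .
    let ?L = "{x\<in>cell X. u x \<le> s0}"
    have "?L = {x\<in>space \<mu>. u x \<le> s0}" by simp
    also have "\<dots> \<in> sets \<mu>" using U_meas[OF u] by measurable
    finally have Ls: "?L \<in> sets \<mu>" .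
    have "m0 / 4 * low_set u = (LINT x|\<mu>. m0 / 4 * indicator ?L x)" using Ls by (simp add: low_set_def Int_cell)
    also have "\<dots> \<le> (LINT x|\<mu>. m x * (h x - r)\<^sup>2)"
    proof (rule integral_mono)
      show "integrable \<mu> (\<lambda>x. m0 / 4 * indicator ?L x)" using integrable_indicator_cell[OF Ls] by auto
      show "integrable \<mu> (\<lambda>x. m x * (h x - r)\<^sup>2)"
        by (intro integrable_cell[OF X] continuous_intros m_cont' h_cont)
      fix x assume x: "x \<in> space \<mu>"
      then have xb: "x \<in> bar X" using cell_bar by auto
      show "m0 / 4 * indicator ?L x \<le> m x * (h x - r)\<^sup>2"
      proof (cases "x \<in> ?L")
        case True
        then have "x \<in> high_level (2 * \<kappa>) u" using low_set_subset_high_level[of \<kappa> u] by auto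
        then have "h x = 1" using th(5) by (simp add: h_def high_level_def)
        then have "(1 / 2)\<^sup>2 \<le> (h x - r)\<^sup>2" using r by (intro power_mono) auto
        then have "m0 * (1 / 4) \<le> m x * (h x - r)\<^sup>2"
          using m0_le_m[OF xb] m0 by (intro mult_mono) (auto simp: power2_eq_square)
        then show ?thesis using True by simp
      next
        case False
        then show ?thesis using m_pos[OF xb] by simp
      qed
    qed
    also note Poincare_m
    also have "c * (LINT x|\<mu>. m x * (norm (G x))\<^sup>2) \<le> \<bar>c\<bar> * (M0 * (L\<^sup>2 / s0) * J)"
    proof (rule mult_mono)
      have "(LINT x|\<mu>. m x * (norm (G x))\<^sup>2) \<le> (LINT x|\<mu>. M0 * (norm (G x))\<^sup>2)"
        by (rule integral_mono) (use m_le_M0 cell_bar in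
          \<open>auto intro!: integrable_cell[OF X] continuous_intros m_cont' G(2) mult_right_mono\<close>)
      also have "\<dots> = M0 * (LINT x|\<mu>. (norm (G x))\<^sup>2)" by simp
      also have "\<dots> \<le> M0 * ((L\<^sup>2 / s0) * J)"
        using integral_le_of_nn_integral_le[OF J(1) G(3) diss] pos M by (intro mult_left_mono) auto
      finally show "(LINT x|\<mu>. m x * (norm (G x))\<^sup>2) \<le> M0 * (L\<^sup>2 / s0) * J" by simp
      show "0 \<le> (LINT x|\<mu>. m x * (norm (G x))\<^sup>2)"
        by (intro integral_nonneg_AE AE_I2) (use m_pos cell_bar in \<open>auto simp: less_imp_le\<close>)
    qed auto
    finally show ?thesis using m0 pos by (simp add: field_simps)
  qed
  moreover have "0 \<le> 4 / m0 * (\<bar>c\<bar> * (M0 * (L\<^sup>2 / s0)))" using m0 M pos by auto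
  ultimately show ?thesis using delta(1) by blast
qed

text \<open>
  If \<open>m\<close> is not an \<open>L\<^sup>1\<close>-limit of the family, the dissipation is bounded below and the small values of \<open>J\<close> do
  not occur.
\<close>

lemma low_set_le_dissipation:
  "\<exists>C\<ge>0. \<forall>u\<in>U. \<forall>J\<ge>0. dissipation u \<le> ennreal J \<longrightarrow> low_set u \<le> C * J"
proof -
  have "\<exists>C\<ge>0. \<exists>\<delta>>0. \<forall>u\<in>U. \<forall>J. 0 \<le> J \<and> J \<le> \<delta> \<and> dissipation u \<le> ennreal J \<longrightarrow> low_set u \<le> C * J"
  proof (cases "\<forall>\<eta>>0. \<exists>u\<in>U. (LINT x|\<mu>. \<bar>u x - m x\<bar>) < \<eta>")
    case True
    then show ?thesis by (intro low_set_le_dissipation_if_close) auto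
  next
    case False
    then obtain \<eta> where eta: "0 < \<eta>" "\<And>u. u \<in> U \<Longrightarrow> \<not> (LINT x|\<mu>. \<bar>u x - m x\<bar>) < \<eta>" by blast
    obtain \<delta> where delta: "0 < \<delta>" "\<And>u. u \<in> U \<Longrightarrow> dissipation u \<le> ennreal \<delta> \<Longrightarrow> (LINT x|\<mu>. \<bar>u x - m x\<bar>) < \<eta>"
      using small_dissipation_L1_close[OF eta(1)] by blast
    have "\<not> dissipation u \<le> ennreal J" if "u \<in> U" "J \<le> \<delta>" for u J
      using delta(2)[OF that(1)] eta(2)[OF that(1)] ennreal_leI[OF that(2)] order_trans by blast
    then show ?thesis using delta(1) by (intro exI[of _ 0] conjI exI[of _ \<delta>]) auto
  qed
  then obtain C \<delta> where C: "0 \<le> C" and delta: "0 < \<delta>"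
    and small: "\<And>u J. u \<in> U \<Longrightarrow> 0 \<le> J \<Longrightarrow> J \<le> \<delta> \<Longrightarrow> dissipation u \<le> ennreal J \<Longrightarrow> low_set u \<le> C * J" by blast
  have "low_set u \<le> (C + T / \<delta>) * J" if u: "u \<in> U" and J: "0 \<le> J" and diss: "dissipation u \<le> ennreal J" for u J
  proof (cases "J \<le> \<delta>")
    case True
    have "0 \<le> T / \<delta> * J" using T delta J by simp
    then show ?thesis using small[OF u J True diss] by (simp add: distrib_right)
  next
    case False
    then have "T \<le> T / \<delta> * J" using T delta by (simp add: field_simps)
    moreover have "0 \<le> C * J" using C J by simp
    ultimately show ?thesis using low_set_le_T[OF u] by (simp add: distrib_right)
  qed
  then show ?thesis using C T delta by (intro exI[of _ "C + T / \<delta>"]) auto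
qed

lemma energy_le_dissipation:
  "\<exists>C>0. \<forall>u\<in>U. (\<integral>\<^sup>+x. ennreal (E x (u x)) \<partial>\<mu>) \<le> ennreal C * dissipation u"
proof -
  obtain C1 where C1: "0 \<le> C1" "\<And>u J. u \<in> U \<Longrightarrow> 0 \<le> J \<Longrightarrow> dissipation u \<le> ennreal J \<Longrightarrow>
     (\<integral>\<^sup>+x. ennreal (E x (u x)) \<partial>\<mu>) \<le> ennreal (C1 * (J + low_set u))"
    using energy_le_dissipation_plus_low_set by blast
  obtain C2 where C2: "0 \<le> C2" "\<And>u J. u \<in> U \<Longrightarrow> 0 \<le> J \<Longrightarrow> dissipation u \<le> ennreal J \<Longrightarrow> low_set u \<le> C2 * J"
    using low_set_le_dissipation by blast
  define C where "C = C1 * (1 + C2) + 1"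
  have C: "0 < C" using C1(1) C2(1) by (simp add: C_def add_nonneg_pos)
  have "(\<integral>\<^sup>+x. ennreal (E x (u x)) \<partial>\<mu>) \<le> ennreal C * dissipation u" if u: "u \<in> U" for u
  proof (cases "dissipation u")
    case top
    then show ?thesis using C by (simp add: ennreal_mult_top)
  next
    case (real J)
    then have le: "dissipation u \<le> ennreal J" by simp
    have "C1 * (J + low_set u) \<le> C1 * (J + C2 * J)"
      using C2(2)[OF u real(1) le] C1(1) by (intro mult_left_mono) auto
    also have "\<dots> \<le> C * J" using real(1) by (simp add: C_def algebra_simps)
    finally have "(\<integral>\<^sup>+x. ennreal (E x (u x)) \<partial>\<mu>) \<le> ennreal (C * J)"
      using C1(2)[OF u real(1) le] ennreal_leI order_trans by blast
    then show ?thesis using C real by (simp add: ennreal_mult')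
  qed
  then show ?thesis using C by blast
qed

end

section \<open>The entropy inequality\<close>

theorem corollary3p11:
  fixes X :: "'a::euclidean_space spatial"
    and E f :: "'a \<Rightarrow> real \<Rightarrow> real"
    and m :: "'a \<Rightarrow> real"
    and U :: "('a \<Rightarrow> real) set"
    and c :: real
  assumes X: "admissible X"
    and E_cont: "continuous_on (bar X \<times> {0..}) (\<lambda>(x, s). E x s)"
    and E_desc: "\<And>s. 0 \<le> s \<Longrightarrow> descends X (\<lambda>x. E x s)"
    and f_C1: "Ck_upto 1 (pts X \<times> {0<..}) (bar X \<times> {0<..}) (\<lambda>(x, s). f x s)"
    and f_desc: "\<And>s. 0 < s \<Longrightarrow> descends X (\<lambda>x. f x s)"
    and m_cont: "Ck_bar 0 X m"
    and m_mass: "(LINT x:cell X|lebesgue. m x) = 1"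
    and E_nonneg: "\<And>x s. x \<in> bar X \<Longrightarrow> 0 \<le> s \<Longrightarrow> 0 \<le> E x s"
    and m_pos: "\<And>x. x \<in> bar X \<Longrightarrow> 0 < m x"
    and E_m: "\<And>x. x \<in> pts X \<Longrightarrow> E x (m x) = 0"
    and E_deriv: "\<And>x s. x \<in> pts X \<Longrightarrow> 0 < s \<Longrightarrow> (E x has_real_derivative - f x s) (at s)"
    and f_deriv: "\<And>x s. x \<in> bar X \<Longrightarrow> 0 < s \<Longrightarrow> \<exists>l<0. (f x has_real_derivative l) (at s)"
    and U_dens: "\<And>u. u \<in> U \<Longrightarrow> smooth_density X u"
    and U_ui: "uniformly_integrable X U"
    and U_Poincare: "\<And>u. u \<in> U \<Longrightarrow> weighted_Poincare X c u"
  shows "\<exists>C>0. \<forall>u\<in>U.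
    (\<integral>\<^sup>+x\<in>cell X. ennreal (E x (u x)) \<partial>lebesgue)
      \<le> ennreal C * (\<integral>\<^sup>+x\<in>cell X. ennreal (u x * (norm (grad (\<lambda>y. f y (u y)) x))\<^sup>2) \<partial>lebesgue)"
proof -
  interpret reaction X E f m
    by unfold_locales (fact X E_cont f_C1 f_desc m_cont m_mass E_nonneg m_pos E_m E_deriv f_deriv)+
  let ?\<mu> = "cell_measure X"
  interpret finite_measure ?\<mu> by (rule finite_cell_measure[OF X])
  have U_C1: "Ck_bar 1 X u" and U_nonneg: "\<And>x. x \<in> bar X \<Longrightarrow> 0 \<le> u x"
    and U_mass: "(LINT x|?\<mu>. u x) = 1" if "u \<in> U" for u
    using U_dens[OF that] unfolding smooth_density_def smooth_bar_def cell_integral_eq[OF X] by auto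
  have ui: "\<exists>d>0. \<forall>u\<in>U. \<forall>A\<in>sets ?\<mu>. measure ?\<mu> A \<le> d \<longrightarrow> (LINT x|?\<mu>. u x * indicator A x) \<le> e"
    if "0 < e" for e
    by (rule uniformly_integrable_cell[OF X U_ui that])
  obtain m0 M0 where m: "0 < m0" "\<And>x. x \<in> bar X \<Longrightarrow> m0 \<le> m x \<and> m x \<le> M0"
    using m_bounds by blast
  obtain d where d: "0 < d" "\<And>u A. u \<in> U \<Longrightarrow> A \<in> sets ?\<mu> \<Longrightarrow> measure ?\<mu> A \<le> d \<Longrightarrow>
      (LINT x|?\<mu>. u x * indicator A x) \<le> 1 / 4"
    using ui[of "1 / 4"] by auto
  \<comment> \<open>By Markov the set \<open>{u > R}\<close> has measure at most \<open>1 / R\<close>, which makes it small enough for \<open>d\<close>.\<close>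
  define R where "R = max (M0 + 1) (max 1 (1 / d))"
  have R: "M0 + 1 \<le> R" "0 < R" "1 / R \<le> d"
  proof -
    show "M0 + 1 \<le> R" "0 < R" by (auto simp: R_def less_max_iff_disj)
    have "1 / d \<le> R" by (simp add: R_def)
    then show "1 / R \<le> d" using d(1) \<open>0 < R\<close> by (simp add: field_simps)
  qed
  have tail: "(LINT x|?\<mu>. u x * indicator {x\<in>cell X. R < u x} x) \<le> 1 / 4" if u: "u \<in> U" for u
  proof (rule d(2)[OF u])
    have u_cont: "continuous_on (bar X) u" using U_C1[OF u] unfolding Ck_bar_1 by blast
    note [measurable] = borel_measurable_cell[OF X u_cont]
    have "{x\<in>space ?\<mu>. R < u x} \<in> sets ?\<mu>" by measurable
    then show H: "{x\<in>cell X. R < u x} \<in> sets ?\<mu>" by simp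
    have "R * measure ?\<mu> {x\<in>cell X. R < u x} = (LINT x|?\<mu>. R * indicator {x\<in>cell X. R < u x} x)"
      using H sets.Int_space_eq2[OF H] by simp
    also have "\<dots> \<le> (LINT x|?\<mu>. u x)"
    proof (rule integral_mono)
      have "integrable ?\<mu> (indicator {x\<in>cell X. R < u x} :: 'a \<Rightarrow> real)"
        using H emeasure_finite[of "{x\<in>cell X. R < u x}"]
        by (intro integrable_real_indicator) (auto simp: less_top[symmetric])
      then show "integrable ?\<mu> (\<lambda>x. R * indicator {x\<in>cell X. R < u x} x)" by simp
      show "integrable ?\<mu> u" by (rule integrable_cell[OF X u_cont])
      show "R * indicator {x\<in>cell X. R < u x} x \<le> u x" if "x \<in> space ?\<mu>" for x
        using that U_nonneg[OF u] cell_subset_pts[of X] pts_subset_bar[of X] by (auto simp: indicator_def)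
    qed
    finally have "measure ?\<mu> {x\<in>cell X. R < u x} \<le> 1 / R"
      using U_mass[OF u] R(2) by (simp add: field_simps)
    then show "measure ?\<mu> {x\<in>cell X. R < u x} \<le> d" using R(3) by simp
  qed
  obtain l \<Lambda> where l: "0 < l" "l \<le> \<Lambda>" "\<And>x s t. x \<in> bar X \<Longrightarrow> m0 / 4 \<le> s \<Longrightarrow> s \<le> t \<Longrightarrow> t \<le> R \<Longrightarrow>
      l * (t - s) \<le> f x s - f x t \<and> f x s - f x t \<le> \<Lambda> * (t - s)"
    using f_slope_bounds[of "m0 / 4" R] m(1) by auto
  interpret reaction_family X E f m m0 M0 R l \<Lambda> U c
    by unfold_locales (use m R l U_C1 U_nonneg U_mass ui tail U_Poincare in auto)
  show ?thesis
    using energy_le_dissipation unfolding dissipation_def cell_nn_integral_eq[OF X] .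
qed

end
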